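(* The class $\mathrm{NA}(\mathcal{B}_u)$ of naturally ordered finite Boolean algebras with one distinguished ideal containing all atoms but exactly one satisfies the Ramsey property.
   Context: Let $L_1=\{\vee,\wedge,0,1,\neg,P_0\}$ be the language of Boolean algebras expanded by one unary predicate symbol $P_0$. An ideal on a Boolean algebra is a subset containing $0$, downward closed under the canonical order and closed under finite joins; ideals are assumed non-trivial, i.e. not containing $1$. $\mathcal{B}_u$ is the class of (isomorphism types of) finite Boolean algebras $A$ in the language $L_1$ in which $P_0$ is interpreted as an ideal and exactly one atom of $A$ is not in $P_0$. Proper and natural orderings: a linear ordering $<$ of the atoms of $A\in\mathcal{B}_u$ is proper if $a<b$ whenever $a,b$ are atoms with $a\in P_0$ and $b\notin P_0$. A linear ordering of $A$ is natural if it is the antilexicographical extension of a proper ordering $a_1<\dots<a_n$ of its atoms: for distinct $x,y\in A$, $x<y$ iff, for the largest $m$ such that exactly one of $a_m\le x$, $a_m\le y$ holds (with $\le$ the Boolean order), we have $a_m\le y$. $\mathrm{NA}(\mathcal{B}_u)$ is the class of all structures $(A,<)$ in the language $L_1\cup\{<\}$ with $A\in\mathcal{B}_u$ and $<$ a natural ordering of $A$. Ramsey property: a class $\mathcal{K}$ of finite structures satisfies the Ramsey property if for all $A,B\in\mathcal{K}$ such that $A$ embeds in $B$ and every natural number $k\ge 2$ there is $C\in\mathcal{K}$ such that for every colouring by $k$ colours of the set of copies of $A$ in $C$ (substructures of $C$ isomorphic to $A$) there is a copy $B'$ of $B$ in $C$ such that all copies of $A$ in $B'$ have the same colour. *)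

theory Defs
  imports Main "HOL-Library.Infinite_Typeclass"
begin

text \<open>
  Structures carry an explicit universe, because the Ramsey property quantifies over structures.
  The operations and the order are total functions; only their behaviour on the universe matters,
  and every notion below is relativised to it.
\<close>

record 'a L1_struct =
  univ  :: "'a set"
  join  :: "'a \<Rightarrow> 'a \<Rightarrow> 'a"
  meet  :: "'a \<Rightarrow> 'a \<Rightarrow> 'a"
  zero  :: 'a
  one   :: 'a
  neg   :: "'a \<Rightarrow> 'a"
  P0    :: "'a set"

record 'a L1_ord_struct = "'a L1_struct" +
  lt    :: "'a \<Rightarrow> 'a \<Rightarrow> bool"

definition closed_under_ops :: "('a, 'm) L1_struct_scheme \<Rightarrow> 'a set \<Rightarrow> bool" where
  "closed_under_ops A S \<longleftrightarrow>
     zero A \<in> S \<and> one A \<in> S \<and>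
     (\<forall>x\<in>S. neg A x \<in> S) \<and>
     (\<forall>x\<in>S. \<forall>y\<in>S. join A x y \<in> S \<and> meet A x y \<in> S)"

text \<open>The laws are those of the locale \<^locale>\<open>abstract_boolean_algebra\<close>, relativised to the
  universe.\<close>

definition boolean_alg :: "('a, 'm) L1_struct_scheme \<Rightarrow> bool" where
  "boolean_alg A \<longleftrightarrow>
     closed_under_ops A (univ A) \<and>
     (\<forall>x\<in>univ A. \<forall>y\<in>univ A. \<forall>z\<in>univ A.
        join A (join A x y) z = join A x (join A y z) \<and>
        meet A (meet A x y) z = meet A x (meet A y z) \<and>
        meet A x (join A y z) = join A (meet A x y) (meet A x z) \<and>
        join A x (meet A y z) = meet A (join A x y) (join A x z)) \<and>
     (\<forall>x\<in>univ A. \<forall>y\<in>univ A.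
        join A x y = join A y x \<and> meet A x y = meet A y x) \<and>
     (\<forall>x\<in>univ A.
        join A x (zero A) = x \<and> meet A x (one A) = x \<and>
        join A x (neg A x) = one A \<and> meet A x (neg A x) = zero A)"

definition ble :: "('a, 'm) L1_struct_scheme \<Rightarrow> 'a \<Rightarrow> 'a \<Rightarrow> bool" where
  "ble A x y \<longleftrightarrow> meet A x y = x"

definition atoms :: "('a, 'm) L1_struct_scheme \<Rightarrow> 'a set" where
  "atoms A = {a \<in> univ A. a \<noteq> zero A \<and> (\<forall>y\<in>univ A. ble A y a \<longrightarrow> y = zero A \<or> y = a)}"

definition nontrivial_ideal :: "('a, 'm) L1_struct_scheme \<Rightarrow> 'a set \<Rightarrow> bool" where
  "nontrivial_ideal A I \<longleftrightarrow>
     I \<subseteq> univ A \<and> zero A \<in> I \<and> one A \<notin> I \<and>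
     (\<forall>x\<in>I. \<forall>y\<in>univ A. ble A y x \<longrightarrow> y \<in> I) \<and>
     (\<forall>x\<in>I. \<forall>y\<in>I. join A x y \<in> I)"

definition in_Bu :: "('a, 'm) L1_struct_scheme \<Rightarrow> bool" where
  "in_Bu A \<longleftrightarrow>
     finite (univ A) \<and> boolean_alg A \<and> nontrivial_ideal A (P0 A) \<and>
     (\<exists>!a. a \<in> atoms A \<and> a \<notin> P0 A)"

text \<open>A linear ordering of the finitely many atoms is given as its increasing enumeration, a list
  without repetitions.\<close>

definition proper_ordering :: "('a, 'm) L1_struct_scheme \<Rightarrow> 'a list \<Rightarrow> bool" where
  "proper_ordering A as \<longleftrightarrow>
     distinct as \<and> set as = atoms A \<and>
     (\<forall>i<length as. \<forall>j<length as. as ! i \<in> P0 A \<and> as ! j \<notin> P0 A \<longrightarrow> i < j)"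

definition antilex :: "('a, 'm) L1_struct_scheme \<Rightarrow> 'a list \<Rightarrow> 'a \<Rightarrow> 'a \<Rightarrow> bool" where
  "antilex A as x y \<longleftrightarrow>
     x \<noteq> y \<and>
     (let m = Max {i. i < length as \<and> ble A (as ! i) x \<noteq> ble A (as ! i) y}
      in ble A (as ! m) y)"

definition natural_ordering :: "('a, 'm) L1_struct_scheme \<Rightarrow> ('a \<Rightarrow> 'a \<Rightarrow> bool) \<Rightarrow> bool" where
  "natural_ordering A r \<longleftrightarrow>
     (\<exists>as. proper_ordering A as \<and> (\<forall>x\<in>univ A. \<forall>y\<in>univ A. r x y \<longleftrightarrow> antilex A as x y))"

text \<open>Universes are subsets of \<open>'a\<close>, so this class represents all isomorphism types when
  \<open>'a\<close> is infinite.\<close>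

definition NA_Bu :: "'a L1_ord_struct set" where
  "NA_Bu = {A. in_Bu A \<and> natural_ordering A (lt A)}"

definition embedding :: "('a \<Rightarrow> 'b) \<Rightarrow> 'a L1_ord_struct \<Rightarrow> 'b L1_ord_struct \<Rightarrow> bool" where
  "embedding f A B \<longleftrightarrow>
     f ` univ A \<subseteq> univ B \<and> inj_on f (univ A) \<and>
     f (zero A) = zero B \<and> f (one A) = one B \<and>
     (\<forall>x\<in>univ A. f (neg A x) = neg B (f x)) \<and>
     (\<forall>x\<in>univ A. \<forall>y\<in>univ A.
        f (join A x y) = join B (f x) (f y) \<and> f (meet A x y) = meet B (f x) (f y)) \<and>
     (\<forall>x\<in>univ A. x \<in> P0 A \<longleftrightarrow> f x \<in> P0 B) \<and>
     (\<forall>x\<in>univ A. \<forall>y\<in>univ A. lt A x y \<longleftrightarrow> lt B (f x) (f y))"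

definition embeds :: "'a L1_ord_struct \<Rightarrow> 'b L1_ord_struct \<Rightarrow> bool" where
  "embeds A B \<longleftrightarrow> (\<exists>f. embedding f A B)"

definition isomorphic :: "'a L1_ord_struct \<Rightarrow> 'b L1_ord_struct \<Rightarrow> bool" where
  "isomorphic A B \<longleftrightarrow> (\<exists>f. embedding f A B \<and> f ` univ A = univ B)"

definition induced :: "'a L1_ord_struct \<Rightarrow> 'a set \<Rightarrow> 'a L1_ord_struct" where
  "induced C S = C\<lparr>univ := S, P0 := P0 C \<inter> S\<rparr>"

text \<open>A substructure is determined by its universe, so copies are represented by their
  universes.\<close>

definition copies :: "'b L1_ord_struct \<Rightarrow> 'a L1_ord_struct \<Rightarrow> 'a set set" where
  "copies A C = {S. S \<subseteq> univ C \<and> closed_under_ops C S \<and> isomorphic A (induced C S)}"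

definition ramsey_property :: "'a L1_ord_struct set \<Rightarrow> bool" where
  "ramsey_property K \<longleftrightarrow>
     (\<forall>A\<in>K. \<forall>B\<in>K. \<forall>k::nat. embeds A B \<and> k \<ge> 2 \<longrightarrow>
       (\<exists>C\<in>K. \<forall>\<chi> :: 'a set \<Rightarrow> nat. \<chi> ` copies A C \<subseteq> {..<k} \<longrightarrow>
         (\<exists>S\<in>copies B C. \<exists>c. \<forall>T\<in>copies A (induced C S). \<chi> T = c)))"

end

theory Submission
  imports Defs "HOL-Library.FuncSet"
begin

text \<open>
  In an algebra of this class with atoms \<open>a_1 < \<dots> < a_n\<close>, properness puts the only atom outside the
  ideal last, so the ideal consists of the elements not above \<open>a_n\<close>. The algebra is therefore determined
  by \<open>n\<close> up to isomorphism (\<open>NA_Bu_isomorphic_std_algebra\<close>). A subalgebra is a partition of the atoms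
  into blocks. Its induced order is the antilexicographic order for the blocks ordered by their largest
  elements, and the block of \<open>a_n\<close> is both the largest one and the only one outside the ideal. So every
  subalgebra lies in the class again, its number of blocks decides what it is a copy of, and the
  Ramsey property becomes the dual Ramsey theorem of Graham and Rothschild: for \<open>k\<close>, \<open>m\<close> and \<open>r\<close> there
  is an \<open>n\<close> such that, however the partitions of an \<open>n\<close>-set into \<open>k\<close> blocks are coloured with \<open>r\<close> colours,
  some partition into \<open>m\<close> blocks has all its coarsenings with \<open>k\<close> blocks of one colour.

  Numbering the atoms from the largest one downwards, starting at 0, and the blocks in order of appearance,
  a partition into blocks becomes a word whose symbols make their first appearances in the order
  \<open>0, 1, 2, \<dots>\<close>, and coarsening becomes substitution of words. The lemmas \<open>embedding_word_preimage\<close> and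
  \<open>embedding_std_algebra_word_preimage\<close> say that these words are exactly the embeddings.

  The dual Ramsey theorem is the case without constants of the Graham-Rothschild theorem for parameter
  words, where the symbols below \<open>t\<close> are constants that need not appear. Its proof is an induction on the
  number of parameters of the words that are coloured. The step has two halves. Write such a word as
  \<open>x @ t # y\<close> with \<open>x\<close> constant; then \<open>y\<close> has one parameter less over an alphabet with one constant more, so
  the induction hypothesis, applied at one position after the other, makes the colour independent of \<open>y\<close>
  (\<open>fixing\<close>). The colour that is left is a colouring of constant words \<open>x\<close>, and the Hales-Jewett theorem
  makes it depend on the length of \<open>x\<close> only (\<open>hales_jewett_prefixes\<close>); the pigeonhole principle
  on the lengths finishes the step. The Hales-Jewett theorem itself is proved by colour focusing.
\<close>

section \<open>Parameter words and substitution\<close>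

text \<open>
  Reading \<open>w\<close> with the symbols below \<open>t\<close> already known, every new symbol must be the least
  unknown one, and in the end exactly the symbols below \<open>s\<close> are known.
\<close>
fun rigid :: "nat \<Rightarrow> nat list \<Rightarrow> nat \<Rightarrow> bool" where
  "rigid t [] s \<longleftrightarrow> s = t"
| "rigid t (x # w) s \<longleftrightarrow> x < t \<and> rigid t w s \<or> x = t \<and> rigid (Suc t) w s"

text \<open>
  The \<open>k\<close>-parameter words of length \<open>n\<close> over the alphabet \<open>{..<t}\<close>. The parameters are the symbols
  \<open>t, \<dots>, t + k - 1\<close>; each of them occurs, and they appear in this order. A word \<open>F\<close> in
  \<open>param_words t n m\<close> stands for an \<open>m\<close>-dimensional combinatorial subspace of \<open>{..<t}\<close>-words of length \<open>n\<close>.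
\<close>
definition param_words :: "nat \<Rightarrow> nat \<Rightarrow> nat \<Rightarrow> nat list set" where
  "param_words t n k = {w. length w = n \<and> rigid t w (t + k)}"

definition subst :: "nat \<Rightarrow> nat list \<Rightarrow> nat list \<Rightarrow> nat list" where
  "subst t w v = map (\<lambda>i. if i < t then i else v ! (i - t)) w"

text \<open>
  Makes room for a new constant \<open>t\<close>: a word over \<open>{..<t}\<close> is read over \<open>{..<Suc t}\<close>.
\<close>
definition raise :: "nat \<Rightarrow> nat list \<Rightarrow> nat list" where
  "raise t w = map (\<lambda>i. if i < t then i else Suc i) w"

lemma rigid_mono: "rigid t w s \<Longrightarrow> t \<le> s"
  by (induction t w s rule: rigid.induct) auto

lemma rigid_set: "rigid t w s \<Longrightarrow> set w \<subseteq> {..<s}"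
  by (induction t w s rule: rigid.induct) (use rigid_mono in fastforce)+

lemma rigid_append: "rigid t u s \<Longrightarrow> rigid s w q \<Longrightarrow> rigid t (u @ w) q"
  by (induction t u s rule: rigid.induct) auto

lemma rigid_self: "rigid t w t \<longleftrightarrow> set w \<subseteq> {..<t}"
  by (induction w) (auto dest: rigid_mono)

lemma rigid_raise: "rigid s w q \<Longrightarrow> t \<le> s \<Longrightarrow> rigid (Suc s) (raise t w) (Suc q)"
  by (induction s w q rule: rigid.induct) (auto simp: raise_def)

lemma rigid_split:
  "rigid t w s \<Longrightarrow> t \<le> p \<Longrightarrow> p < s \<Longrightarrow> \<exists>x y. w = x @ p # y \<and> rigid t x p \<and> rigid (Suc p) y s"
proof (induction w arbitrary: t)
  case (Cons a w)
  show ?case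
  proof (cases "a = p \<and> t = p")
    case True
    with Cons.prems show ?thesis by (intro exI[of _ "[]"] exI[of _ w]) (auto dest: rigid_mono)
  next
    case False
    define t' where "t' = (if a < t then t else Suc t)"
    have "rigid t' w s" "t' \<le> p" using Cons.prems False by (auto simp: t'_def)
    then obtain x y where "w = x @ p # y" "rigid t' x p" "rigid (Suc p) y s"
      using Cons.IH Cons.prems(3) by blast
    with Cons.prems(1) show ?thesis by (intro exI[of _ "a # x"] exI[of _ y]) (auto simp: t'_def split: if_splits)
  qed
qed auto

text \<open>
  This is the closure of parameter words under substitution, in the form that goes through by
  induction: \<open>e\<close> holds the values of the symbols met so far and \<open>v\<close> those still to come, so the
  induction moves the head of \<open>v\<close> to \<open>e\<close> at each new symbol.
\<close>
lemma rigid_map: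
  "rigid t w s \<Longrightarrow> length e = t \<Longrightarrow> set e \<subseteq> {..<a} \<Longrightarrow> length v = s - t \<Longrightarrow> rigid a v b
   \<Longrightarrow> rigid a (map (\<lambda>i. (e @ v) ! i) w) b"
proof (induction w arbitrary: t e v a)
  case (Cons x w)
  consider "x < t" "rigid t w s" | "x = t" "rigid (Suc t) w s" using Cons.prems(1) by auto
  then show ?case
  proof cases
    case 1
    then have "(e @ v) ! x < a"
      using Cons.prems(2,3) nth_mem[of x e] by (fastforce simp: nth_append)
    then show ?thesis using Cons.IH[OF 1(2) Cons.prems(2-5)] by simp
  next
    case 2
    then have "t < s" using rigid_mono by fastforce
    then obtain b0 v' where v: "v = b0 # v'" using Cons.prems(4) by (cases v) auto
    have x: "(e @ v) ! x = b0" using 2 Cons.prems(2) v by (simp add: nth_append)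
    have e: "e @ v = (e @ [b0]) @ v'" using v by simp
    show ?thesis
    proof (cases "b0 < a")
      case True
      then have "rigid a v' b" using Cons.prems(5) v by auto
      then have "rigid a (map (\<lambda>i. ((e @ [b0]) @ v') ! i) w) b"
        using True Cons.prems v by (intro Cons.IH[OF 2(2)]) auto
      then show ?thesis using x e True by simp
    next
      case False
      then have "b0 = a" "rigid (Suc a) v' b" using Cons.prems(5) v by auto
      then have "rigid (Suc a) (map (\<lambda>i. ((e @ [b0]) @ v') ! i) w) b"
        using Cons.prems v by (intro Cons.IH[OF 2(2)]) (auto simp: less_Suc_eq)
      then show ?thesis using x e \<open>b0 = a\<close> by simp
    qed
  qed
qed auto

lemma subst_param_words:
  assumes "F \<in> param_words t n m" "v \<in> param_words t m k"
  shows "subst t F v \<in> param_words t n k"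
proof -
  have "rigid t (map (\<lambda>i. ([0..<t] @ v) ! i) F) (t + k)"
    using assms by (intro rigid_map) (auto simp: param_words_def)
  also have "map (\<lambda>i. ([0..<t] @ v) ! i) F = subst t F v"
    by (simp add: subst_def nth_append)
  finally show ?thesis using assms by (simp add: param_words_def subst_def)
qed

lemma param_words_set: "w \<in> param_words t n k \<Longrightarrow> set w \<subseteq> {..<t + k}"
  by (auto simp: param_words_def dest: rigid_set)

lemma param_words_0: "param_words t n 0 = {w. length w = n \<and> set w \<subseteq> {..<t}}"
  by (simp add: param_words_def rigid_self)

lemma finite_param_words_0: "finite (param_words t n 0)"
  using finite_lists_length_eq[of "{..<t}" n] by (auto simp: param_words_0 elim: rev_finite_subset)

lemma subst_assoc:
  assumes "set F \<subseteq> {..<t + m}" "length v = m"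
  shows "subst t (subst t F v) u = subst t F (subst t v u)"
  using assms by (fastforce simp: subst_def)

lemma subst_append: "subst t (u @ w) v = subst t u v @ subst t w v"
  by (simp add: subst_def)

lemma subst_const: "set w \<subseteq> {..<t} \<Longrightarrow> subst t w v = w"
  by (auto simp: subst_def intro!: map_idI)

lemma subst_set:
  assumes "set w \<subseteq> {..<t + length v}" "set v \<subseteq> {..<t}"
  shows "set (subst t w v) \<subseteq> {..<t}"
proof -
  have "v ! (i - t) < t" if "i \<in> set w" "\<not> i < t" for i
  proof -
    have "i - t < length v" using assms(1) that by auto
    then show ?thesis using assms(2) nth_mem by blast
  qed
  then show ?thesis by (auto simp: subst_def)
qed

text \<open>
  This trades a parameter for a constant: a parameter that a substitution leaves in place behaves like
  one more letter of the alphabet.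
\<close>
lemma subst_self_Cons: "subst t w (t # y) = subst (Suc t) w y"
  by (auto simp: subst_def nth_Cons' Suc_diff_le)

lemma subst_cong_prefix:
  "set w \<subseteq> {..<t + length x} \<Longrightarrow> subst t w (x @ y) = subst t w x"
  by (auto simp: subst_def nth_append)

lemma subst_raise: "subst t (raise t w) (a # v) = subst t w v"
  by (auto simp: subst_def raise_def)

lemma subst_raise_line: "set l \<subseteq> {..<Suc t} \<Longrightarrow> subst (Suc t) (raise t l) [a] = subst t l [a]"
  by (fastforce simp: subst_def raise_def)

text \<open>
  The subspace \<open>F\<close> is used inside the coordinates of \<open>H\<close>, where \<open>H\<close> has the additional constant \<open>t\<close>.
  Instantiating that constant by \<open>a\<close> afterwards gives the same as instantiating it in \<open>H\<close>.
\<close>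
lemma subst_subst_raise:
  assumes "set H \<subseteq> {..<Suc t + N}" "length F = N"
  shows "subst t (subst (Suc t) H (raise t F)) (a # v) = subst t H (a # subst t F v)"
proof -
  have "(let j = if i < Suc t then i else raise t F ! (i - Suc t)
         in if j < t then j else (a # v) ! (j - t))
        = (if i < t then i else (a # subst t F v) ! (i - t))" if "i \<in> set H" for i
  proof (cases "i \<le> t")
    case True
    then show ?thesis by (auto simp: Let_def)
  next
    case False
    then have "i - Suc t < N" "i - t = Suc (i - Suc t)" using assms(1) that by auto
    then show ?thesis using False assms(2) by (auto simp: Let_def raise_def subst_def)
  qed
  then show ?thesis by (auto simp: subst_def Let_def)
qed

section \<open>Colourings\<close>

text \<open>
  Each Ramsey statement below says that some object \<open>F\<close> of a family \<open>S\<close> has prescribed pairs of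
  points equally coloured. Asking for equal pairs rather than one colour allows several
  monochromatic sets within one \<open>F\<close>.
\<close>
definition homogenizable :: "nat \<Rightarrow> 'f set \<Rightarrow> ('f \<Rightarrow> ('a \<times> 'a) set) \<Rightarrow> bool" where
  "homogenizable r S D \<longleftrightarrow>
     (\<forall>\<chi> :: 'a \<Rightarrow> nat. (\<forall>x. \<chi> x < r) \<longrightarrow> (\<exists>F\<in>S. \<forall>(x, y)\<in>D F. \<chi> x = \<chi> y))"

text \<open>
  Finitely many colourings \<open>c i\<close> can be handled at once: the function \<open>i \<mapsto> c i x\<close> is
  a single colour of \<open>x\<close>, out of \<open>r ^ card I\<close> many.
\<close>
lemma homogenizable_simultaneous:
  assumes hom: "homogenizable (r ^ card I) S D" and I: "finite I" and c: "\<And>i x. i \<in> I \<Longrightarrow> c i x < r"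
  shows "\<exists>F\<in>S. \<forall>(x, y)\<in>D F. \<forall>i\<in>I. c i x = c i y"
proof -
  let ?M = "I \<rightarrow>\<^sub>E {..<r}"
  have fin: "finite ?M" using I by (intro finite_PiE) auto
  have card: "card ?M = r ^ card I" using I by (simp add: card_PiE)
  obtain h where h: "bij_betw h ?M {0..<card ?M}" using ex_bij_betw_finite_nat[OF fin] by blast
  have mem: "(\<lambda>i\<in>I. c i x) \<in> ?M" for x using c by auto
  have "h (\<lambda>i\<in>I. c i x) < r ^ card I" for x
    using bij_betwE[OF h] mem[of x] card by fastforce
  then obtain F where F: "F \<in> S" "\<forall>(x, y)\<in>D F. h (\<lambda>i\<in>I. c i x) = h (\<lambda>i\<in>I. c i y)"
    using hom[unfolded homogenizable_def, rule_format, of "\<lambda>x. h (\<lambda>i\<in>I. c i x)"] by blast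
  have "c i x = c i y" if "(x, y) \<in> D F" "i \<in> I" for x y i
  proof -
    have "(\<lambda>i\<in>I. c i x) = (\<lambda>i\<in>I. c i y)"
      using F(2) that mem h by (intro inj_onD[of h ?M]) (auto simp: bij_betw_def)
    then show ?thesis using that(2) by (metis restrict_apply')
  qed
  then show ?thesis using F(1) by blast
qed

section \<open>The Hales-Jewett theorem\<close>

definition line_pairs :: "nat \<Rightarrow> nat list \<Rightarrow> (nat list \<times> nat list) set" where
  "line_pairs t l = {(subst t l [a], subst t l [b]) | a b. a < t \<and> b < t}"

text \<open>
  Focusing configurations over the alphabet \<open>{..<Suc t}\<close>: constant words \<open>w 0, \<dots>, w m\<close> and, for
  \<open>i < j\<close>, a line \<open>l i j\<close> ending in \<open>w j\<close>. The pairs to be coloured equally compare the other points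
  of \<open>l i j\<close> with \<open>w i\<close>, so that the whole line is monochromatic as soon as \<open>w i\<close> and \<open>w j\<close> agree in
  colour.
\<close>
definition focused ::
  "nat \<Rightarrow> nat \<Rightarrow> nat \<Rightarrow> ((nat \<Rightarrow> nat list) \<times> (nat \<Rightarrow> nat \<Rightarrow> nat list)) set" where
  "focused t N m = {(w, l). (\<forall>i\<le>m. w i \<in> param_words (Suc t) N 0) \<and>
     (\<forall>i j. i < j \<and> j \<le> m \<longrightarrow> l i j \<in> param_words (Suc t) N 1 \<and> subst (Suc t) (l i j) [t] = w j)}"

definition focused_pairs ::
  "nat \<Rightarrow> nat \<Rightarrow> (nat \<Rightarrow> nat list) \<times> (nat \<Rightarrow> nat \<Rightarrow> nat list) \<Rightarrow> (nat list \<times> nat list) set" where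
  "focused_pairs t m = (\<lambda>(w, l).
     {(subst (Suc t) (l i j) [a], w i) | i j a. i < j \<and> j \<le> m \<and> a < t})"

lemma param_words_append: "u \<in> param_words t n k \<Longrightarrow> w \<in> param_words (t + k) n' k' \<Longrightarrow> u @ w \<in> param_words t (n + n') (k + k')"
  by (auto simp: param_words_def add.assoc intro: rigid_append)

lemma param_words_raise: "w \<in> param_words t n k \<Longrightarrow> raise t w \<in> param_words (Suc t) n k"
  using rigid_raise[of t w "t + k" t] by (auto simp: param_words_def raise_def)

lemma single_param_words_0: "a < t \<Longrightarrow> [a] \<in> param_words t (Suc 0) 0"
  by (simp add: param_words_0)

text \<open>
  Prepend a new block of coordinates to a configuration on \<open>N\<close> coordinates. The block is so long that
  the Hales-Jewett theorem for \<open>t\<close> letters applies to the colouring which records the colours of all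
  continuations of length \<open>N\<close>; it gives a line \<open>l\<close> whose points at letters below \<open>t\<close> are interchangeable.
  The old configuration, chosen with respect to both the continuations of \<open>l\<close> at 0 and those of \<open>l\<close>
  at \<open>t\<close>, is put behind \<open>l\<close> at \<open>t\<close>, and the word \<open>l\<close> at 0 followed by \<open>w 0\<close> becomes the new first word.
\<close>
lemma focusing:
  assumes HJ: "\<And>r. \<exists>L. homogenizable r (param_words t L 1) (line_pairs t)"
  shows "\<exists>N. homogenizable r (focused t N m) (focused_pairs t m)"
proof (induction m arbitrary: r)
  case 0
  have "(\<lambda>_. [], \<lambda>_ _. []) \<in> focused t 0 0" by (simp add: focused_def param_words_0)
  moreover have "focused_pairs t 0 F = {}" for F by (auto simp: focused_pairs_def split: prod.splits)
  ultimately show ?case unfolding homogenizable_def by blast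
next
  case (Suc m)
  obtain N where N: "homogenizable (r ^ card {0, t}) (focused t N m) (focused_pairs t m)" using Suc by blast
  let ?Z = "param_words (Suc t) N 0"
  obtain L where L: "homogenizable (r ^ card ?Z) (param_words t L 1) (line_pairs t)" using HJ by blast
  have "\<exists>F\<in>focused t (L + N) (Suc m). \<forall>(x, y)\<in>focused_pairs t (Suc m) F. \<chi> x = \<chi> y"
    if \<chi>: "\<forall>x. \<chi> x < r" for \<chi> :: "nat list \<Rightarrow> nat"
  proof -
    obtain l where l: "l \<in> param_words t L 1"
      and lmono: "\<forall>(x, y)\<in>line_pairs t l. \<forall>z\<in>?Z. \<chi> (x @ z) = \<chi> (y @ z)"
      using homogenizable_simultaneous[OF L finite_param_words_0, of "\<lambda>z x. \<chi> (x @ z)"] \<chi> by blast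
    have lmono: "\<chi> (subst t l [a] @ z) = \<chi> (subst t l [b] @ z)" if "a < t" "b < t" "z \<in> ?Z" for a b z
      using lmono that by (fastforce simp: line_pairs_def)
    obtain w k where wk: "(w, k) \<in> focused t N m"
      and foc: "\<forall>(x, y)\<in>focused_pairs t m (w, k).
        \<forall>a\<in>{0, t}. \<chi> (subst t l [a] @ x) = \<chi> (subst t l [a] @ y)"
      using homogenizable_simultaneous[OF N, of "\<lambda>a x. \<chi> (subst t l [a] @ x)"] \<chi> by auto
    have foc: "\<chi> (subst t l [b] @ subst (Suc t) (k i j) [a]) = \<chi> (subst t l [b] @ w i)"
      if "i < j" "j \<le> m" "a < t" "b \<in> {0, t}" for i j a b
      using foc that by (fastforce simp: focused_pairs_def)
    have w: "w i \<in> ?Z" if "i \<le> m" for i using wk that by (auto simp: focused_def)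
    have k: "k i j \<in> param_words (Suc t) N 1" "subst (Suc t) (k i j) [t] = w j" if "i < j" "j \<le> m" for i j
      using wk that by (auto simp: focused_def)
    have wc: "subst (Suc t) (w i) [a] = w i" if "i \<le> m" for i a
      using w[OF that] by (intro subst_const) (auto simp: param_words_0)
    have lset: "set l \<subseteq> {..<Suc t}" using param_words_set[OF l] by simp
    have la: "subst t l [a] \<in> param_words (Suc t) L 0" if "a \<le> t" for a
    proof -
      have "set (subst t l [a]) \<subseteq> {..<Suc t}" using lset that by (fastforce simp: subst_def)
      then show ?thesis using l by (simp add: param_words_0) (simp add: param_words_def subst_def)
    qed
    have lac: "subst (Suc t) (subst t l [a]) [b] = subst t l [a]" if "a \<le> t" for a b
      using la[OF that] by (intro subst_const) (auto simp: param_words_0)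
    \<comment> \<open>The new line from the first word to the word of index \<open>Suc j\<close> continues with
          \<open>tail j\<close>; for \<open>j = 0\<close> only the new block moves.\<close>
    define tail where "tail j = (if j = 0 then w 0 else k 0 j)" for j
    have tail: "subst (Suc t) (tail j) [a] \<in> ?Z" "subst (Suc t) (tail j) [t] = w j"
      "raise t l @ tail j \<in> param_words (Suc t) (L + N) 1"
      if "j \<le> m" "a \<le> t" for j a
    proof -
      show "subst (Suc t) (tail j) [a] \<in> ?Z"
        using w[of 0] k[of 0 j] that wc[of 0 a] subst_param_words[of "k 0 j" "Suc t" N 1 "[a]" 0]
        by (auto simp: tail_def single_param_words_0)
      show "subst (Suc t) (tail j) [t] = w j" using k[of 0 j] wc[of 0] that by (auto simp: tail_def)
      have "rigid (Suc t) (raise t l) (Suc (Suc t))"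
        using param_words_raise[OF l] by (auto simp: param_words_def)
      moreover have "rigid (Suc (Suc t)) (tail j) (Suc (Suc t))"
        using w[of 0] k[of 0 j] that param_words_set[of "k 0 j" "Suc t" N 1]
        by (auto simp: tail_def rigid_self param_words_0 less_Suc_eq)
      moreover have "length (raise t l) = L" "length (tail j) = N"
        using l w[of 0] k[of 0 j] that by (auto simp: param_words_def raise_def tail_def)
      ultimately show "raise t l @ tail j \<in> param_words (Suc t) (L + N) 1"
        by (auto simp: param_words_def intro: rigid_append)
    qed
    define W where "W i = (case i of 0 \<Rightarrow> subst t l [0] @ w 0 | Suc i' \<Rightarrow> subst t l [t] @ w i')" for i
    define K where "K i j = (case i of 0 \<Rightarrow> raise t l @ tail (j - 1)
                             | Suc i' \<Rightarrow> subst t l [t] @ k i' (j - 1))" for i j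
    have W: "W i \<in> param_words (Suc t) (L + N) 0" if "i \<le> Suc m" for i
    proof (cases i)
      case 0
      then show ?thesis using la[of 0] w[of 0] by (simp add: W_def param_words_0)
    next
      case (Suc i')
      then show ?thesis using la[of t] w[of i'] that by (simp add: W_def param_words_0)
    qed
    have K: "K i (Suc j) \<in> param_words (Suc t) (L + N) 1" "subst (Suc t) (K i (Suc j)) [t] = W (Suc j)"
      if "i \<le> j" "j \<le> m" for i j
    proof -
      show "K i (Suc j) \<in> param_words (Suc t) (L + N) 1"
      proof (cases i)
        case 0
        then show ?thesis using tail(3)[of j t] that by (simp add: K_def)
      next
        case (Suc i')
        then show ?thesis
          using that la[of t] k(1)[of i' j] param_words_append[of "subst t l [t]" "Suc t" L 0 "k i' j" N 1]
          by (simp add: K_def)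
      qed
      show "subst (Suc t) (K i (Suc j)) [t] = W (Suc j)"
      proof (cases i)
        case 0
        then show ?thesis using tail(2)[of j t] that lset
          by (simp add: K_def W_def subst_append subst_raise_line)
      next
        case (Suc i')
        then show ?thesis using that k(2)[of i' j] lac[of t t] by (simp add: K_def W_def subst_append)
      qed
    qed
    have "(W, K) \<in> focused t (L + N) (Suc m)"
    proof -
      have "K i j \<in> param_words (Suc t) (L + N) 1 \<and> subst (Suc t) (K i j) [t] = W j"
        if "i < j" "j \<le> Suc m" for i j
        using that K[of i "j - 1"] by (cases j) auto
      then show ?thesis using W by (auto simp: focused_def)
    qed
    moreover have "\<chi> (subst (Suc t) (K i (Suc j)) [a]) = \<chi> (W i)"
      if "i \<le> j" "j \<le> m" "a < t" for i j a
    proof (cases i)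
      case 0
      have "\<chi> (subst (Suc t) (K i (Suc j)) [a]) = \<chi> (subst t l [a] @ subst (Suc t) (tail j) [a])"
        using 0 lset by (simp add: K_def subst_append subst_raise_line)
      also have "\<dots> = \<chi> (subst t l [0] @ subst (Suc t) (tail j) [a])"
        using that tail[of j a] by (intro lmono) auto
      also have "\<dots> = \<chi> (subst t l [0] @ w 0)"
        using foc[of 0 j a 0] that wc[of 0 a] by (auto simp: tail_def)
      finally show ?thesis using 0 by (simp add: W_def)
    next
      case (Suc i')
      then show ?thesis using foc[of i' j a t] that lac[of t a] by (simp add: K_def W_def subst_append)
    qed
    then have "\<chi> (subst (Suc t) (K i j) [a]) = \<chi> (W i)" if "i < j" "j \<le> Suc m" "a < t" for i j a
      using that by (cases j) auto
    then have "\<forall>(x, y)\<in>focused_pairs t (Suc m) (W, K). \<chi> x = \<chi> y"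
      by (auto simp: focused_pairs_def)
    ultimately show ?thesis by blast
  qed
  then show ?case unfolding homogenizable_def by blast
qed

text \<open>
  Induction on the alphabet. Among the \<open>r + 1\<close> words of a focusing configuration of size \<open>r\<close>, two have the
  same colour, and the line joining them is monochromatic.
\<close>
theorem hales_jewett: "\<exists>L. homogenizable r (param_words t L 1) (line_pairs t)"
proof (induction t arbitrary: r)
  case 0
  have "[0] \<in> param_words 0 1 1" "line_pairs 0 [0] = {}" by (auto simp: param_words_def line_pairs_def)
  then show ?case unfolding homogenizable_def by blast
next
  case (Suc t)
  obtain N where N: "homogenizable r (focused t N r) (focused_pairs t r)" using focusing Suc by blast
  have "\<exists>F\<in>param_words (Suc t) N 1. \<forall>(x, y)\<in>line_pairs (Suc t) F. \<chi> x = \<chi> y"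
    if \<chi>: "\<forall>x. \<chi> x < r" for \<chi> :: "nat list \<Rightarrow> nat"
  proof -
    obtain w k where wk: "(w, k) \<in> focused t N r"
      and foc: "\<forall>(x, y)\<in>focused_pairs t r (w, k). \<chi> x = \<chi> y"
      using N \<chi> unfolding homogenizable_def by (metis surj_pair)
    have "\<not> inj_on (\<lambda>i. \<chi> (w i)) {..r}"
    proof (rule pigeonhole)
      have "card ((\<lambda>i. \<chi> (w i)) ` {..r}) \<le> card {..<r}"
        using \<chi> by (intro card_mono) auto
      then show "card ((\<lambda>i. \<chi> (w i)) ` {..r}) < card {..r}" by simp
    qed
    then obtain i j where ij: "i < j" "j \<le> r" "\<chi> (w i) = \<chi> (w j)"
      unfolding inj_on_def by (metis atMost_iff nat_neq_iff)
    have k: "k i j \<in> param_words (Suc t) N 1" "subst (Suc t) (k i j) [t] = w j"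
      using wk ij by (auto simp: focused_def)
    have "\<chi> (subst (Suc t) (k i j) [a]) = \<chi> (w i)" if "a < Suc t" for a
    proof (cases "a = t")
      case False
      then have "(subst (Suc t) (k i j) [a], w i) \<in> focused_pairs t r (w, k)"
        unfolding focused_pairs_def using ij that False by (simp add: less_Suc_eq) blast
      then show ?thesis using foc by blast
    qed (use k ij in auto)
    then show ?thesis using k(1) by (intro bexI[of _ "k i j"]) (auto simp: line_pairs_def)
  qed
  then show ?case unfolding homogenizable_def by blast
qed

section \<open>Colourings of constant prefixes\<close>

text \<open>
  The words compared are the constant words that a subspace \<open>G\<close> takes before its \<open>j\<close>-th parameter
  appears, for \<open>j\<close> fixed. For \<open>j = m\<close> these are all constant words of the subspace.
\<close>
definition prefix_pairs :: "nat \<Rightarrow> nat \<Rightarrow> nat list \<Rightarrow> (nat list \<times> nat list) set" where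
  "prefix_pairs t m G = {(subst t (takeWhile (\<lambda>i. i < t + j) G) v,
                          subst t (takeWhile (\<lambda>i. i < t + j) G) v') | j v v'.
                          j \<le> m \<and> v \<in> param_words t j 0 \<and> v' \<in> param_words t j 0}"

lemma prefix_pairsI:
  "j \<le> m \<Longrightarrow> v \<in> param_words t j 0 \<Longrightarrow> v' \<in> param_words t j 0 \<Longrightarrow>
   (subst t (takeWhile (\<lambda>i. i < t + j) G) v, subst t (takeWhile (\<lambda>i. i < t + j) G) v')
     \<in> prefix_pairs t m G"
  unfolding prefix_pairs_def by blast

text \<open>
  Prefixes of different lengths are coloured at the same time. The induction puts one line \<open>l\<close> in front of
  a subspace \<open>G\<close>, where \<open>l\<close> is monochromatic for all continuations of length at most that of \<open>G\<close>; so
  \<open>G\<close> may be chosen with the first coordinate frozen at the constant 0.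
\<close>
lemma hales_jewett_prefixes:
  assumes "0 < t"
  shows "\<exists>M. homogenizable r (param_words t M m) (prefix_pairs t m)"
proof (induction m)
  case 0
  have "[] \<in> param_words t 0 0" by (simp add: param_words_0)
  moreover have "\<forall>(x, y)\<in>prefix_pairs t 0 []. \<chi> x = \<chi> y" for \<chi> :: "nat list \<Rightarrow> nat"
    by (simp add: prefix_pairs_def subst_def)
  ultimately show ?case unfolding homogenizable_def by blast
next
  case (Suc m)
  then obtain M where M: "homogenizable r (param_words t M m) (prefix_pairs t m)" by blast
  let ?Z = "{z. set z \<subseteq> {..<t} \<and> length z \<le> M}"
  have Z: "finite ?Z" by (simp add: finite_lists_length_le)
  obtain L where L: "homogenizable (r ^ card ?Z) (param_words t L 1) (line_pairs t)" using hales_jewett by blast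
  have "\<exists>G\<in>param_words t (L + M) (Suc m). \<forall>(x, y)\<in>prefix_pairs t (Suc m) G. \<chi> x = \<chi> y"
    if \<chi>: "\<forall>x. \<chi> x < r" for \<chi> :: "nat list \<Rightarrow> nat"
  proof -
    obtain l where l: "l \<in> param_words t L 1"
      and lmono: "\<forall>(x, y)\<in>line_pairs t l. \<forall>z\<in>?Z. \<chi> (x @ z) = \<chi> (y @ z)"
      using homogenizable_simultaneous[OF L Z, of "\<lambda>z x. \<chi> (x @ z)"] \<chi> by blast
    have lmono: "\<chi> (subst t l [a] @ z) = \<chi> (subst t l [b] @ z)" if "a < t" "b < t" "z \<in> ?Z" for a b z
      using lmono that by (fastforce simp: line_pairs_def)
    obtain G where G: "G \<in> param_words t M m"
      and Gmono: "\<forall>(x, y)\<in>prefix_pairs t m G. \<chi> (subst t l [0] @ x) = \<chi> (subst t l [0] @ y)"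
      using M[unfolded homogenizable_def, rule_format, of "\<lambda>x. \<chi> (subst t l [0] @ x)"] \<chi> by blast
    have lset: "set l \<subseteq> {..<Suc t}" using param_words_set[OF l] by simp
    define G' where "G' = l @ raise t G"
    have G': "G' \<in> param_words t (L + M) (Suc m)"
      using param_words_append[OF l, of "raise t G" M m] param_words_raise[OF G] by (simp add: G'_def)
    have take: "takeWhile (\<lambda>i. i < t + Suc j) G' = l @ raise t (takeWhile (\<lambda>i. i < t + j) G)" for j
    proof -
      have "takeWhile (\<lambda>i. i < t + Suc j) (raise t G) = raise t (takeWhile (\<lambda>i. i < t + j) G)"
        by (induction G) (auto simp: raise_def)
      moreover have "\<forall>i\<in>set l. i < t + Suc j" using lset by auto
      ultimately show ?thesis by (simp add: G'_def del: add_Suc_right)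
    qed
    have z: "subst t (takeWhile (\<lambda>i. i < t + j) G) v \<in> ?Z" if v: "v \<in> param_words t j 0" for j v
    proof -
      have "set (takeWhile (\<lambda>i. i < t + j) G) \<subseteq> {..<t + j}" by (auto dest: set_takeWhileD)
      then have "set (subst t (takeWhile (\<lambda>i. i < t + j) G) v) \<subseteq> {..<t}"
        using v by (intro subst_set) (auto simp: param_words_0)
      then show ?thesis using G by (auto simp: subst_def param_words_def length_takeWhile_le)
    qed
    have step: "\<chi> (subst t (takeWhile (\<lambda>i. i < t + Suc j) G') (a # v))
          = \<chi> (subst t (takeWhile (\<lambda>i. i < t + Suc j) G') (a' # v'))"
      if "j \<le> m" "v \<in> param_words t j 0" "v' \<in> param_words t j 0" "a < t" "a' < t" for j v v' a a'
    proof -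
      let ?x = "\<lambda>v. subst t (takeWhile (\<lambda>i. i < t + j) G) v"
      have eq: "subst t (takeWhile (\<lambda>i. i < t + Suc j) G') (b # u) = subst t l [b] @ ?x u" for b u
      proof -
        have "subst t l (b # u) = subst t l [b]" using subst_cong_prefix[of l t "[b]" u] lset by simp
        then show ?thesis by (simp add: take subst_append subst_raise del: add_Suc_right)
      qed
      have "\<chi> (subst t l [a] @ ?x v) = \<chi> (subst t l [0] @ ?x v)"
        using that z assms by (intro lmono) auto
      also have "\<dots> = \<chi> (subst t l [0] @ ?x v')"
        using Gmono that by (fastforce simp: prefix_pairs_def)
      also have "\<dots> = \<chi> (subst t l [a'] @ ?x v')"
        using that z assms by (intro lmono) auto
      finally show ?thesis unfolding eq .
    qed
    have "\<chi> (subst t (takeWhile (\<lambda>i. i < t + j) G') v) = \<chi> (subst t (takeWhile (\<lambda>i. i < t + j) G') v')"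
      if "j \<le> Suc m" "v \<in> param_words t j 0" "v' \<in> param_words t j 0" for j v v'
    proof (cases j)
      case 0
      then show ?thesis using that by (simp add: param_words_0)
    next
      case (Suc j')
      have "length v = Suc j'" "length v' = Suc j'" using that Suc by (auto simp: param_words_0)
      then obtain a u a' u' where "v = a # u" "v' = a' # u'" by (auto simp: length_Suc_conv)
      then show ?thesis using that Suc step[of j' u u' a a'] by (simp add: param_words_0)
    qed
    then show ?thesis using G' by (intro bexI[of _ G']) (auto simp: prefix_pairs_def)
  qed
  then show ?case unfolding homogenizable_def by blast
qed

section \<open>The Graham-Rothschild theorem\<close>

definition subspace_pairs :: "nat \<Rightarrow> nat \<Rightarrow> nat \<Rightarrow> nat list \<Rightarrow> (nat list \<times> nat list) set" where
  "subspace_pairs t m k F = {(subst t F v, subst t F v') | v v'. v \<in> param_words t m k \<and> v' \<in> param_words t m k}"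

text \<open>
  Two words are compared if they agree up to the first appearance of a parameter.
\<close>
definition fixing_pairs :: "nat \<Rightarrow> nat \<Rightarrow> nat \<Rightarrow> nat list \<Rightarrow> (nat list \<times> nat list) set" where
  "fixing_pairs t m k F = {(subst t F (x @ t # y), subst t F (x @ t # y')) | x y y'.
     set x \<subseteq> {..<t} \<and> x @ t # y \<in> param_words t m (Suc k) \<and> x @ t # y' \<in> param_words t m (Suc k)}"

lemma param_words_new_Cons: "t # y \<in> param_words t (Suc n) (Suc k) \<longleftrightarrow> y \<in> param_words (Suc t) n k"
  by (auto simp: param_words_def)

lemma param_words_old_Cons: "a < t \<Longrightarrow> a # y \<in> param_words t (Suc n) k \<longleftrightarrow> y \<in> param_words t n k"
  by (auto simp: param_words_def)

lemma subst_new_Cons: "subst t (t # w) (a # v) = a # subst t w (a # v)"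
  by (simp add: subst_def)

text \<open>
  Induction on the dimension. The words starting with the parameter \<open>t\<close> are handled by the
  Graham-Rothschild theorem for one parameter less, with \<open>t\<close> as an additional constant, which gives \<open>H\<close>.
  Words starting with a constant \<open>a\<close> see the coordinates of \<open>H\<close> with \<open>t\<close> replaced by \<open>a\<close>; the induction
  hypothesis serves all \<open>t\<close> values of \<open>a\<close> simultaneously, by a subspace \<open>F\<close> of those coordinates.
\<close>
lemma fixing:
  assumes GR: "\<And>m r. \<exists>n. homogenizable r (param_words (Suc t) n m) (subspace_pairs (Suc t) m k)"
  shows "\<exists>n. homogenizable r (param_words t n m) (fixing_pairs t m k)"
proof (induction m arbitrary: r)
  case 0
  have "[] \<in> param_words t 0 0" "fixing_pairs t 0 k [] = {}"
    by (auto simp: param_words_0 fixing_pairs_def param_words_def)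
  then show ?case unfolding homogenizable_def by (metis empty_iff)
next
  case (Suc m)
  obtain N where N: "homogenizable (r ^ card {..<t}) (param_words t N m) (fixing_pairs t m k)" using Suc by blast
  obtain n where n: "homogenizable r (param_words (Suc t) n N) (subspace_pairs (Suc t) N k)" using GR by blast
  have "\<exists>F\<in>param_words t (Suc n) (Suc m). \<forall>(x, y)\<in>fixing_pairs t (Suc m) k F. \<chi> x = \<chi> y"
    if \<chi>: "\<forall>x. \<chi> x < r" for \<chi> :: "nat list \<Rightarrow> nat"
  proof -
    obtain H where H: "H \<in> param_words (Suc t) n N"
      and Hmono: "\<forall>(x, y)\<in>subspace_pairs (Suc t) N k H. \<chi> (t # x) = \<chi> (t # y)"
      using n[unfolded homogenizable_def, rule_format, of "\<lambda>x. \<chi> (t # x)"] \<chi> by blast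
    obtain F where F: "F \<in> param_words t N m"
      and Fmono: "\<forall>(x, y)\<in>fixing_pairs t m k F. \<forall>a\<in>{..<t}.
        \<chi> (a # subst t H (a # x)) = \<chi> (a # subst t H (a # y))"
      using homogenizable_simultaneous[OF N finite_lessThan, of "\<lambda>a x. \<chi> (a # subst t H (a # x))"] \<chi> by blast
    have Hset: "set H \<subseteq> {..<Suc t + N}" using param_words_set[OF H] .
    have lenF: "length F = N" using F by (simp add: param_words_def)
    have rF: "raise t F \<in> param_words (Suc t) N m" using param_words_raise[OF F] .
    define F' where "F' = t # subst (Suc t) H (raise t F)"
    have F': "F' \<in> param_words t (Suc n) (Suc m)"
      unfolding F'_def param_words_new_Cons using subst_param_words[OF H rF] .
    have "\<chi> (subst t F' (x @ t # y)) = \<chi> (subst t F' (x @ t # y'))"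
      if x: "set x \<subseteq> {..<t}" and y: "x @ t # y \<in> param_words t (Suc m) (Suc k)"
        and y': "x @ t # y' \<in> param_words t (Suc m) (Suc k)" for x y y'
    proof (cases x)
      case Nil
      have eq: "subst t F' (t # u) = t # subst (Suc t) H (subst (Suc t) (raise t F) u)" for u
      proof -
        have "subst t F' (t # u) = t # subst t (subst (Suc t) H (raise t F)) (t # u)"
          by (simp only: F'_def subst_new_Cons)
        then show ?thesis
          using subst_assoc[OF Hset, of "raise t F" u] rF by (simp add: subst_self_Cons param_words_def)
      qed
      have "subst (Suc t) (raise t F) u \<in> param_words (Suc t) N k" if "t # u \<in> param_words t (Suc m) (Suc k)" for u
        using that subst_param_words[OF rF] by (simp add: param_words_new_Cons)
      then have "(subst (Suc t) H (subst (Suc t) (raise t F) y), subst (Suc t) H (subst (Suc t) (raise t F) y'))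
          \<in> subspace_pairs (Suc t) N k H"
        using y y' Nil unfolding subspace_pairs_def by auto
      then have "\<chi> (t # subst (Suc t) H (subst (Suc t) (raise t F) y))
          = \<chi> (t # subst (Suc t) H (subst (Suc t) (raise t F) y'))"
        using Hmono by blast
      then show ?thesis using Nil by (simp add: eq)
    next
      case (Cons a x')
      then have a: "a < t" and x': "set x' \<subseteq> {..<t}" using x by auto
      have eq: "subst t F' (a # u) = a # subst t H (a # subst t F u)" for u
        using subst_subst_raise[OF Hset lenF] by (simp add: F'_def subst_new_Cons)
      have "(subst t F (x' @ t # y), subst t F (x' @ t # y')) \<in> fixing_pairs t m k F"
        using x' y y' Cons a unfolding fixing_pairs_def by (auto simp: param_words_old_Cons)
      then show ?thesis using Fmono a Cons by (auto simp: eq)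
    qed
    then show ?thesis using F' by (intro bexI[of _ F']) (auto simp: fixing_pairs_def)
  qed
  then show ?case unfolding homogenizable_def by blast
qed

text \<open>
  The subspace with its parameters at the positions in \<open>J\<close> and the constant 0 elsewhere: in each of its
  points, the first parameter stands at a position in \<open>J\<close>.
\<close>
lemma spread_param_words:
  fixes J :: "nat set"
  assumes "0 < t"
  shows "map (\<lambda>j. if j \<in> J then t + card (J \<inter> {..<j}) else 0) [0..<n] \<in> param_words t n (card (J \<inter> {..<n}))"
proof -
  have "rigid t (map (\<lambda>j. if j \<in> J then t + card (J \<inter> {..<j}) else 0) [0..<n]) (t + card (J \<inter> {..<n}))"
  proof (induction n)
    case (Suc n)
    have "J \<inter> {..<Suc n} = (if n \<in> J then insert n (J \<inter> {..<n}) else J \<inter> {..<n})"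
      by (auto simp: less_Suc_eq)
    then have "rigid (t + card (J \<inter> {..<n})) [if n \<in> J then t + card (J \<inter> {..<n}) else 0]
      (t + card (J \<inter> {..<Suc n}))"
      using assms by simp
    from rigid_append[OF Suc this] show ?case by simp
  qed simp
  then show ?thesis by (simp add: param_words_def)
qed

lemma large_colour_class:
  fixes \<kappa> :: "nat \<Rightarrow> nat"
  assumes "\<And>j. \<kappa> j < r"
  shows "\<exists>J q. J \<subseteq> {..<r * m} \<and> card J = m \<and> (\<forall>j\<in>J. \<kappa> j = q)"
proof -
  have "\<exists>q\<in>{..<r}. card {..<r * m} \<le> card (\<kappa> -` {q} \<inter> {..<r * m}) * card {..<r}"
    using assms[of 0] by (intro pigeonhole_card) (use assms in auto)
  then obtain q where "r * m \<le> card (\<kappa> -` {q} \<inter> {..<r * m}) * r" by auto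
  then have "m \<le> card (\<kappa> -` {q} \<inter> {..<r * m})" using assms[of 0] by (simp add: mult.commute)
  then obtain J where "J \<subseteq> \<kappa> -` {q} \<inter> {..<r * m}" "card J = m"
    using obtain_subset_with_card_n by metis
  then show ?thesis by blast
qed

text \<open>
  After \<open>fixing\<close>, the colour of \<open>x @ t # y\<close> is a function \<open>c\<close> of \<open>x\<close>. After restriction to the subspace
  \<open>G\<close> of \<open>hales_jewett_prefixes\<close>, it is a function \<open>\<kappa>\<close> of the length of \<open>x\<close> before substitution. Among
  \<open>r * m\<close> lengths, \<open>m\<close> have the same value of \<open>\<kappa>\<close>, and \<open>spread_param_words\<close> confines the first
  parameter to these.
\<close>
theorem graham_rothschild:
  "0 < t \<Longrightarrow> \<exists>n. homogenizable r (param_words t n m) (subspace_pairs t m k)"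
proof (induction k arbitrary: t m r)
  case 0
  obtain M where M: "homogenizable r (param_words t M m) (prefix_pairs t m)"
    using hales_jewett_prefixes[OF 0] by blast
  have "subspace_pairs t m 0 F \<subseteq> prefix_pairs t m F" if "F \<in> param_words t M m" for F
  proof -
    have F: "takeWhile (\<lambda>i. i < t + m) F = F" using param_words_set[OF that] by auto
    have "(subst t F v, subst t F v') \<in> prefix_pairs t m F"
      if "v \<in> param_words t m 0" "v' \<in> param_words t m 0" for v v'
      using prefix_pairsI[of m m v t v' F] that F by simp
    then show ?thesis by (auto simp: subspace_pairs_def)
  qed
  then show ?case using M unfolding homogenizable_def by (meson subsetD)
next
  case (Suc k)
  obtain M where M: "homogenizable r (param_words t M (r * m)) (prefix_pairs t (r * m))"
    using hales_jewett_prefixes[OF Suc.prems] by blast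
  obtain n where n: "homogenizable r (param_words t n M) (fixing_pairs t M k)"
    using fixing[OF Suc.IH] by blast
  have "\<exists>F\<in>param_words t n m. \<forall>(x, y)\<in>subspace_pairs t m (Suc k) F. \<chi> x = \<chi> y"
    if \<chi>: "\<forall>x. \<chi> x < r" for \<chi> :: "nat list \<Rightarrow> nat"
  proof -
    obtain F where F: "F \<in> param_words t n M" and Fmono: "\<forall>(x, y)\<in>fixing_pairs t M k F. \<chi> x = \<chi> y"
      using n \<chi> unfolding homogenizable_def by blast
    \<comment> \<open>The choice of \<open>y\<close> is immaterial by the pairs of \<open>fixing\<close>; words \<open>x\<close> that have no continuation get an arbitrary colour below \<open>r\<close>.\<close>
    define c where "c x = \<chi> (subst t F (x @ t # (SOME y. x @ t # y \<in> param_words t M (Suc k))))" for x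
    have c: "\<chi> (subst t F (x @ t # y)) = c x"
      if "set x \<subseteq> {..<t}" "x @ t # y \<in> param_words t M (Suc k)" for x y
    proof -
      have "x @ t # (SOME y. x @ t # y \<in> param_words t M (Suc k)) \<in> param_words t M (Suc k)"
        using that(2) by (rule someI)
      then show ?thesis using Fmono that unfolding fixing_pairs_def c_def by blast
    qed
    have c_less: "c x < r" for x using \<chi> by (simp add: c_def)
    obtain G where G: "G \<in> param_words t M (r * m)"
      and Gmono: "\<forall>(x, y)\<in>prefix_pairs t (r * m) G. c x = c y"
      using M c_less unfolding homogenizable_def by blast
    define \<kappa> where "\<kappa> j = c (subst t (takeWhile (\<lambda>i. i < t + j) G) (replicate j 0))" for j
    obtain J q where J: "J \<subseteq> {..<r * m}" "card J = m" and q: "\<forall>j\<in>J. \<kappa> j = q"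
      using large_colour_class[of \<kappa> r m] c_less by (auto simp: \<kappa>_def)
    define E where "E = map (\<lambda>j. if j \<in> J then t + card (J \<inter> {..<j}) else 0) [0..<r * m]"
    have E: "E \<in> param_words t (r * m) m"
      using spread_param_words[OF Suc.prems, of J "r * m"] J by (simp add: E_def Int_absorb2)
    have key: "\<chi> (subst t F (subst t G (subst t E v))) = q" if v: "v \<in> param_words t m (Suc k)" for v
    proof -
      have u: "subst t E v \<in> param_words t (r * m) (Suc k)" using subst_param_words[OF E v] .
      obtain x y where xy: "subst t E v = x @ t # y" and x: "set x \<subseteq> {..<t}"
        using rigid_split[of t "subst t E v" "t + Suc k" t] u by (auto simp: param_words_def rigid_self)
      define j where "j = length x"
      have jlen: "j < r * m" using arg_cong[OF xy, of length] u by (simp add: param_words_def j_def)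
      have "subst t E v ! j = t" by (simp add: xy j_def)
      moreover have "subst t E v ! j = 0" if "j \<notin> J"
        using that jlen Suc.prems by (simp add: subst_def E_def)
      ultimately have "j \<in> J" using Suc.prems by fastforce
      obtain P Q where G_eq: "G = P @ (t + j) # Q" and P: "rigid t P (t + j)"
        using rigid_split[of t G "t + r * m" "t + j"] G jlen by (auto simp: param_words_def)
      have Pset: "set P \<subseteq> {..<t + j}" using rigid_set[OF P] .
      have take: "takeWhile (\<lambda>i. i < t + j) G = P" unfolding G_eq using Pset
        by (subst takeWhile_append2) auto
      have Gu: "subst t G (subst t E v) = subst t P x @ t # subst t Q (subst t E v)"
        using subst_cong_prefix[of P t x "t # y"] Pset
        by (simp add: G_eq xy subst_append j_def) (simp add: subst_def)
      have Px: "subst t P x \<in> param_words t (length P) 0"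
        using subst_param_words[of P t "length P" j x 0] P x by (simp add: param_words_def j_def rigid_self)
      have "\<chi> (subst t F (subst t G (subst t E v))) = c (subst t P x)"
        using c[of "subst t P x" "subst t Q (subst t E v)"] Px subst_param_words[OF G u]
        by (simp add: Gu param_words_0)
      also have "\<dots> = \<kappa> j"
      proof -
        have "x \<in> param_words t j 0" "replicate j 0 \<in> param_words t j 0"
          using x Suc.prems by (auto simp: param_words_0 j_def)
        then have "(subst t P x, subst t P (replicate j 0)) \<in> prefix_pairs t (r * m) G"
          using prefix_pairsI[of j "r * m" x t "replicate j 0" G] jlen take by simp
        then show ?thesis using Gmono by (auto simp: \<kappa>_def take)
      qed
      finally show ?thesis using q \<open>j \<in> J\<close> by simp
    qed
    define K where "K = subst t F (subst t G E)"
    have "subst t K v = subst t F (subst t G (subst t E v))" for v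
      using param_words_set[OF F] param_words_set[OF G] E G subst_param_words[OF G E]
      by (simp add: K_def subst_assoc[of _ t M] subst_assoc[of _ t "r * m"] param_words_def)
    moreover have "K \<in> param_words t n m"
      unfolding K_def by (intro subst_param_words[OF F] subst_param_words[OF G] E)
    ultimately show ?thesis using key by (intro bexI[of _ K]) (auto simp: subspace_pairs_def)
  qed
  then show ?case unfolding homogenizable_def by blast
qed

text \<open>
  A word without constants starts with the parameter 0, and the rest of it is a word over
  the one-letter alphabet \<open>{0}\<close> with one parameter less.
\<close>
corollary dual_ramsey:
  "\<exists>n. homogenizable r (param_words 0 n (Suc m)) (subspace_pairs 0 (Suc m) (Suc k))"
proof -
  obtain n where n: "homogenizable r (param_words (Suc 0) n m) (subspace_pairs (Suc 0) m k)"
    using graham_rothschild by blast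
  have "\<exists>F\<in>param_words 0 (Suc n) (Suc m). \<forall>(x, y)\<in>subspace_pairs 0 (Suc m) (Suc k) F. \<chi> x = \<chi> y"
    if \<chi>: "\<forall>x. \<chi> x < r" for \<chi> :: "nat list \<Rightarrow> nat"
  proof -
    obtain F where F: "F \<in> param_words (Suc 0) n m"
      and Fmono: "\<forall>(x, y)\<in>subspace_pairs (Suc 0) m k F. \<chi> (0 # x) = \<chi> (0 # y)"
      using n[unfolded homogenizable_def, rule_format, of "\<lambda>x. \<chi> (0 # x)"] \<chi> by blast
    have shape: "\<exists>u. v = 0 # u \<and> u \<in> param_words (Suc 0) m k" if "v \<in> param_words 0 (Suc m) (Suc k)" for v
      using that by (cases v) (auto simp: param_words_def)
    have "subst 0 (0 # F) (0 # u) = 0 # subst (Suc 0) F u" for u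
      by (simp only: subst_new_Cons subst_self_Cons[of 0 F u])
    then have "\<chi> (subst 0 (0 # F) v) = \<chi> (subst 0 (0 # F) v')"
      if "v \<in> param_words 0 (Suc m) (Suc k)" "v' \<in> param_words 0 (Suc m) (Suc k)" for v v'
      using shape[OF that(1)] shape[OF that(2)] Fmono unfolding subspace_pairs_def by fastforce
    then show ?thesis using F
      by (intro bexI[of _ "0 # F"]) (auto simp: subspace_pairs_def param_words_new_Cons)
  qed
  then show ?thesis unfolding homogenizable_def by blast
qed

section \<open>Copies as images of embeddings\<close>

lemma embedding_comp:
  "embedding f A B \<Longrightarrow> embedding g B C \<Longrightarrow> embedding (g \<circ> f) A C"
  unfolding embedding_def by (auto simp: image_subset_iff inj_on_def)

lemma embedding_induced_iff:
  "embedding f A (induced C S) \<and> S \<subseteq> univ C \<longleftrightarrow> embedding f A C \<and> f ` univ A \<subseteq> S \<and> S \<subseteq> univ C"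
  unfolding embedding_def induced_def by (auto simp: image_subset_iff)

text \<open>
  Replacing copies by embeddings removes induced substructures from the argument, in
  particular the nested ones in the copies of \<open>A\<close> inside a copy of \<open>B\<close>.
\<close>
lemma copies_eq:
  assumes "closed_under_ops A (univ A)"
  shows "copies A C = {f ` univ A | f. embedding f A C}"
proof (intro equalityI subsetI)
  fix S assume "S \<in> copies A C"
  then obtain f where "embedding f A (induced C S)" "f ` univ A = S" "S \<subseteq> univ C"
    by (auto simp: copies_def isomorphic_def induced_def)
  then show "S \<in> {f ` univ A | f. embedding f A C}"
    using embedding_induced_iff[of f A C S] by blast
next
  fix S assume "S \<in> {f ` univ A | f. embedding f A C}"
  then obtain f where f: "embedding f A C" and S: "S = f ` univ A" by blast
  have "S \<subseteq> univ C" using f S by (simp add: embedding_def)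
  moreover have "closed_under_ops C S"
  proof -
    have "zero C = f (zero A)" "one C = f (one A)"
      "\<And>x. x \<in> univ A \<Longrightarrow> neg C (f x) = f (neg A x)"
      "\<And>x y. x \<in> univ A \<Longrightarrow> y \<in> univ A \<Longrightarrow> join C (f x) (f y) = f (join A x y)"
      "\<And>x y. x \<in> univ A \<Longrightarrow> y \<in> univ A \<Longrightarrow> meet C (f x) (f y) = f (meet A x y)"
      using f by (simp_all add: embedding_def)
    then show ?thesis using assms by (auto simp: closed_under_ops_def S)
  qed
  moreover have "isomorphic A (induced C S)"
    using embedding_induced_iff[of f A C S] f S \<open>S \<subseteq> univ C\<close>
    by (auto simp: isomorphic_def induced_def)
  ultimately show "S \<in> copies A C" by (simp add: copies_def)
qed

lemma embedding_factor:
  assumes A: "closed_under_ops A (univ A)" and B: "closed_under_ops B (univ B)"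
    and f: "embedding f A C" and g: "embedding g B C" and im: "f ` univ A \<subseteq> g ` univ B"
  obtains h where "embedding h A B" "\<And>x. x \<in> univ A \<Longrightarrow> g (h x) = f x"
proof -
  define h where "h = inv_into (univ B) g \<circ> f"
  have gh: "g (h x) = f x" "h x \<in> univ B" if "x \<in> univ A" for x
    using im that by (auto simp: h_def f_inv_into_f inv_into_into image_subset_iff)
  have inj: "inj_on g (univ B)" "inj_on f (univ A)" using f g by (auto simp: embedding_def)
  have h_eq: "h x = y" if "f x = g y" "x \<in> univ A" "y \<in> univ B" for x y
    using that inj(1) by (simp add: h_def)
  have "embedding h A B"
    unfolding embedding_def
  proof (intro conjI ballI)
    show "h ` univ A \<subseteq> univ B" using gh(2) by blast
    show "inj_on h (univ A)" using gh(1) inj(2) unfolding inj_on_def by metis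
    show "h (zero A) = zero B" "h (one A) = one B"
      using f g A B by (auto intro!: h_eq simp: embedding_def closed_under_ops_def)
  next
    fix x assume x: "x \<in> univ A"
    show "h (neg A x) = neg B (h x)"
      using f g A B gh[OF x] x by (intro h_eq) (auto simp: embedding_def closed_under_ops_def)
    show "(x \<in> P0 A) = (h x \<in> P0 B)" using f g gh[OF x] x by (simp add: embedding_def)
    fix y assume y: "y \<in> univ A"
    show "h (join A x y) = join B (h x) (h y)"
      using f g A B gh[OF x] gh[OF y] x y by (intro h_eq) (auto simp: embedding_def closed_under_ops_def)
    show "h (meet A x y) = meet B (h x) (h y)"
      using f g A B gh[OF x] gh[OF y] x y by (intro h_eq) (auto simp: embedding_def closed_under_ops_def)
    show "lt A x y = lt B (h x) (h y)"
      using f g gh[OF x] gh[OF y] x y by (simp add: embedding_def)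
  qed
  then show ?thesis using that gh by blast
qed

section \<open>Standard algebras and their embeddings\<close>

text \<open>
  The antilexicographic order of a power set, with the atoms numbered from the largest one downwards.
\<close>
definition first_less :: "nat set \<Rightarrow> nat set \<Rightarrow> bool" where
  "first_less X Y \<longleftrightarrow> (\<exists>i. i \<in> Y \<and> i \<notin> X \<and> (\<forall>j<i. j \<in> X \<longleftrightarrow> j \<in> Y))"

lemma first_less_asym: "first_less X Y \<Longrightarrow> \<not> first_less Y X"
  unfolding first_less_def by (metis nat_neq_iff)

lemma first_less_irrefl: "\<not> first_less X X"
  unfolding first_less_def by blast

lemma first_less_total: "X \<noteq> Y \<Longrightarrow> first_less X Y \<or> first_less Y X"
proof -
  assume "X \<noteq> Y"
  then obtain i where i: "(i \<in> X) \<noteq> (i \<in> Y)" by blast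
  define p where "p = (LEAST i. (i \<in> X) \<noteq> (i \<in> Y))"
  have "(p \<in> X) \<noteq> (p \<in> Y)" unfolding p_def using i by (rule LeastI)
  moreover have "(j \<in> X) = (j \<in> Y)" if "j < p" for j using not_less_Least that unfolding p_def by blast
  ultimately show ?thesis unfolding first_less_def by blast
qed

text \<open>
  The member of the class with \<open>n\<close> atoms. The atom \<open>{0}\<close> is the largest one, and the only one
  outside the ideal.
\<close>
definition std_algebra :: "nat \<Rightarrow> nat set L1_ord_struct" where
  "std_algebra n = \<lparr>univ = Pow {..<n}, join = (\<union>), meet = (\<inter>), zero = {}, one = {..<n},
            neg = (\<lambda>X. {..<n} - X), P0 = {X \<in> Pow {..<n}. 0 \<notin> X}, lt = first_less\<rparr>"

lemma std_algebra_simps [simp]: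
  "univ (std_algebra n) = Pow {..<n}" "join (std_algebra n) = (\<union>)" "meet (std_algebra n) = (\<inter>)" "zero (std_algebra n) = {}"
  "one (std_algebra n) = {..<n}" "neg (std_algebra n) = (\<lambda>X. {..<n} - X)"
  "P0 (std_algebra n) = {X \<in> Pow {..<n}. 0 \<notin> X}" "lt (std_algebra n) = first_less"
  by (simp_all add: std_algebra_def)

lemma closed_std_algebra: "closed_under_ops (std_algebra n) (univ (std_algebra n))"
  by (auto simp: closed_under_ops_def)

text \<open>
  A word partitions its positions into blocks by symbol. A set of symbols is sent to the union of
  the blocks it names.
\<close>
definition word_preimage :: "nat list \<Rightarrow> nat set \<Rightarrow> nat set" where
  "word_preimage w X = {i. i < length w \<and> w ! i \<in> X}"

lemma word_preimage_subst:
  "set F \<subseteq> {..<length v} \<Longrightarrow> word_preimage F (word_preimage v X) = word_preimage (subst 0 F v) X"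
  by (auto simp: word_preimage_def subst_def dest: nth_mem)

lemma rigid_first_occurrence:
  assumes "rigid 0 w s" "p < s"
  shows "\<exists>i<length w. w ! i = p \<and> (\<forall>j<i. w ! j < p)"
proof -
  obtain x y where w: "w = x @ p # y" "rigid 0 x p" using rigid_split[OF assms(1)] assms(2) by blast
  then have "set x \<subseteq> {..<p}" using rigid_set by blast
  then have "x ! j < p" if "j < length x" for j using that nth_mem by blast
  then show ?thesis using w by (intro exI[of _ "length x"]) (auto simp: nth_append)
qed

text \<open>
  Two sets of symbols that differ first at \<open>p\<close> have preimages that differ first at the first
  occurrence of \<open>p\<close>, since smaller symbols are the only ones before it. This is how the order of
  first appearances translates into preservation of the order.
\<close>
lemma embedding_word_preimage:
  assumes F: "F \<in> param_words 0 n (Suc m)"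
  shows "embedding (word_preimage F) (std_algebra (Suc m)) (std_algebra n)"
proof -
  have len: "length F = n" and rig: "rigid 0 F (Suc m)" using F by (auto simp: param_words_def)
  have sym: "F ! i < Suc m" if "i < n" for i using rigid_set[OF rig] that len nth_mem by blast
  have zero: "0 < n" "F ! 0 = 0"
    using rigid_first_occurrence[OF rig, of 0] len by auto
  have less: "first_less (word_preimage F X) (word_preimage F Y)" if "first_less X Y" "Y \<subseteq> {..<Suc m}" for X Y
  proof -
    obtain p where p: "p \<in> Y" "p \<notin> X" "\<forall>q<p. q \<in> X \<longleftrightarrow> q \<in> Y"
      using \<open>first_less X Y\<close> by (auto simp: first_less_def)
    then obtain i where "i < length F" "F ! i = p" "\<forall>j<i. F ! j < p"
      using rigid_first_occurrence[OF rig, of p] \<open>Y \<subseteq> {..<Suc m}\<close> by blast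
    then show ?thesis unfolding first_less_def using p by (intro exI[of _ i]) (auto simp: word_preimage_def)
  qed
  have inj: "X = Y" if "word_preimage F X = word_preimage F Y" "X \<subseteq> {..<Suc m}" "Y \<subseteq> {..<Suc m}" for X Y
    using that less[of X Y] less[of Y X] first_less_total[of X Y] first_less_irrefl by metis
  have lt: "first_less X Y \<longleftrightarrow> first_less (word_preimage F X) (word_preimage F Y)"
    if "X \<subseteq> {..<Suc m}" "Y \<subseteq> {..<Suc m}" for X Y
    using that less[of X Y] less[of Y X] first_less_total[of X Y] first_less_asym first_less_irrefl by metis
  show ?thesis
    unfolding embedding_def using len zero sym lt inj by (auto simp: inj_on_def word_preimage_def)
qed

text \<open>
  In a word over \<open>{..<s}\<close> the symbols appear in increasing order as soon as every occurrence of a symbol is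
  preceded by all smaller ones. The induction removes the last letter; if it occurs only there, it is \<open>s - 1\<close>.
\<close>
lemma rigidI:
  assumes "set w = {..<s}" "\<And>j p. j < length w \<Longrightarrow> p < w ! j \<Longrightarrow> p \<in> set (take j w)"
  shows "rigid 0 w s"
  using assms
proof (induction w arbitrary: s rule: rev_induct)
  case Nil
  then show ?case using lessThan_eq_iff[of 0 s] by simp
next
  case (snoc a w)
  have below: "p \<in> set w" if "p < a" for p using snoc.prems(2)[of "length w" p] that by simp
  have cond: "p \<in> set (take j w)" if "j < length w" "p < w ! j" for j p
    using snoc.prems(2)[of j p] that by (simp add: nth_append)
  have as: "a < s" using snoc.prems(1) by auto
  show ?case
  proof (cases "a \<in> set w")
    case True
    then have "rigid 0 w s" using snoc.IH[OF _ cond] snoc.prems(1) by (simp add: insert_absorb)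
    then show ?thesis using as rigid_append[of 0 w s "[a]" s] by simp
  next
    case False
    have "\<not> a < b" if b: "b \<in> set w" for b
    proof
      assume "a < b"
      obtain j where "j < length w" "w ! j = b" using b by (metis in_set_conv_nth)
      then have "a \<in> set (take j w)" using cond \<open>a < b\<close> by blast
      then show False using False set_take_subset by fast
    qed
    then have "set w = {..<a}" using below False by (force simp: not_less_iff_gr_or_eq)
    moreover from this have "s = Suc a"
      using snoc.prems(1) by (simp add: lessThan_Suc[symmetric])
    ultimately show ?thesis
      using snoc.IH[OF _ cond] rigid_append[of 0 w a "[a]" "Suc a"] by simp
  qed
qed

text \<open>
  The images of the atoms are the blocks of a partition, and \<open>v\<close> reads off the block of each
  position. If \<open>p < q\<close> then the atom \<open>{q}\<close> lies below \<open>{p}\<close> in the order; as its image is disjoint from that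
  of \<open>{p}\<close>, the block of \<open>p\<close> has a position before all those of \<open>q\<close>, which gives rigidity.
\<close>
lemma embedding_std_algebra_word_preimage:
  assumes f: "embedding f (std_algebra k) (std_algebra m)"
  obtains v where "v \<in> param_words 0 m k" "\<And>X. X \<subseteq> {..<k} \<Longrightarrow> f X = word_preimage v X"
proof -
  have f0: "f {} = {}" and f1: "f {..<k} = {..<m}" and inj: "inj_on f (Pow {..<k})"
    and fjoin: "\<And>X Y. X \<subseteq> {..<k} \<Longrightarrow> Y \<subseteq> {..<k} \<Longrightarrow> f (X \<union> Y) = f X \<union> f Y"
    and fmeet: "\<And>X Y. X \<subseteq> {..<k} \<Longrightarrow> Y \<subseteq> {..<k} \<Longrightarrow> f (X \<inter> Y) = f X \<inter> f Y"
    and flt: "\<And>X Y. X \<subseteq> {..<k} \<Longrightarrow> Y \<subseteq> {..<k} \<Longrightarrow> first_less X Y \<longleftrightarrow> first_less (f X) (f Y)"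
    using f by (auto simp: embedding_def)
  have un: "f X = (\<Union>p\<in>X. f {p})" if "X \<subseteq> {..<k}" for X
  proof -
    have "finite X" using that finite_subset by blast
    then show ?thesis using that
    proof (induction X)
      case (insert p X)
      then show ?case using fjoin[of "{p}" X] by auto
    qed (simp add: f0)
  qed
  have disj: "f {p} \<inter> f {q} = {}" if "p < k" "q < k" "p \<noteq> q" for p q
    using fmeet[of "{p}" "{q}"] that f0 by simp
  define v where "v = map (\<lambda>i. SOME p. p < k \<and> i \<in> f {p}) [0..<m]"
  have v: "v ! i < k \<and> i \<in> f {v ! i}" if "i < m" for i
  proof -
    have "\<exists>p. p < k \<and> i \<in> f {p}" using un[of "{..<k}"] f1 that by auto
    then show ?thesis using that someI_ex[of "\<lambda>p. p < k \<and> i \<in> f {p}"] by (simp add: v_def)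
  qed
  have v_iff: "i \<in> f {p} \<longleftrightarrow> i < m \<and> v ! i = p" if "p < k" for i p
  proof -
    have "f {p} \<subseteq> {..<m}" using f that by (auto simp: embedding_def image_subset_iff)
    then show ?thesis using v[of i] disj[of p "v ! i"] that by blast
  qed
  have fv: "f X = word_preimage v X" if "X \<subseteq> {..<k}" for X
  proof -
    have "length v = m" by (simp add: v_def)
    then have "i \<in> (\<Union>p\<in>X. f {p}) \<longleftrightarrow> i \<in> word_preimage v X" for i
      using v_iff that by (auto simp: word_preimage_def)
    then show ?thesis using un[OF that] by blast
  qed
  have "rigid 0 v k"
  proof (rule rigidI)
    have "p \<in> set v" if "p < k" for p
    proof -
      have "f {p} \<noteq> {}" using inj_onD[OF inj, of "{p}" "{}"] f0 that by auto
      then obtain i where "i < m" "v ! i = p" using v_iff[OF \<open>p < k\<close>] by auto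
      then show ?thesis using nth_mem[of i v] by (simp add: v_def)
    qed
    then show "set v = {..<k}" using v by (fastforce simp: v_def in_set_conv_nth)
    fix j p assume j: "j < length v" and p: "p < v ! j"
    have jm: "j < m" using j by (simp add: v_def)
    have "first_less {v ! j} {p}" using p by (auto simp: first_less_def)
    then have "first_less (f {v ! j}) (f {p})" using flt v[OF jm] p by auto
    then obtain i where i: "i \<in> f {p}" "\<forall>j'<i. j' \<in> f {v ! j} \<longleftrightarrow> j' \<in> f {p}"
      by (auto simp: first_less_def)
    have "p < k" using p v[OF jm] by simp
    have "i < j"
    proof (rule ccontr)
      assume "\<not> i < j"
      then have "j \<in> f {p}" using i v[OF jm] by (metis nat_neq_iff)
      then show False using v_iff[OF \<open>p < k\<close>] p by simp
    qed
    then show "p \<in> set (take j v)"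
      using i(1) v_iff[OF \<open>p < k\<close>] j by (auto simp: in_set_conv_nth)
  qed
  then show ?thesis using that[of v] fv by (simp add: param_words_def v_def)
qed

section \<open>Members of the class are standard algebras\<close>

text \<open>
  The list \<open>as\<close> enumerates the atoms increasingly, so its reversal numbers them as in
  the standard algebras.
\<close>
definition atom_positions :: "('a, 'm) L1_struct_scheme \<Rightarrow> 'a list \<Rightarrow> 'a \<Rightarrow> nat set" where
  "atom_positions A as x = {i. i < length as \<and> ble A (rev as ! i) x}"

text \<open>
  Reversing the list of atoms turns the largest position where two elements differ into the least one.
  The assumption excludes distinct elements with the same atoms below them, for which the maximum in
  \<open>antilex\<close> is taken over the empty set.
\<close>
lemma antilex_iff_first_less:
  assumes "x \<noteq> y \<Longrightarrow> atom_positions A as x \<noteq> atom_positions A as y"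
  shows "antilex A as x y \<longleftrightarrow> first_less (atom_positions A as x) (atom_positions A as y)"
proof (cases "x = y")
  case True
  then show ?thesis by (simp add: antilex_def first_less_irrefl)
next
  case False
  let ?n = "length as" and ?X = "atom_positions A as x" and ?Y = "atom_positions A as y"
  define D where "D = {i. i < ?n \<and> ble A (as ! i) x \<noteq> ble A (as ! i) y}"
  have pos: "i \<in> atom_positions A as z \<longleftrightarrow> i < ?n \<and> ble A (as ! (?n - Suc i)) z" for i z
    by (auto simp: atom_positions_def rev_nth)
  have "D \<noteq> {}"
  proof -
    obtain i where "(i \<in> ?X) \<noteq> (i \<in> ?Y)" using assms False by blast
    then have "?n - Suc i \<in> D" by (auto simp: pos D_def)
    then show ?thesis by blast
  qed
  moreover have "finite D" by (simp add: D_def)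
  ultimately have M: "Max D \<in> D" "\<And>i. i \<in> D \<Longrightarrow> i \<le> Max D" by auto
  define p where "p = ?n - Suc (Max D)"
  have Mn: "Max D < ?n" using M(1) by (simp add: D_def)
  have pM: "p < ?n" "?n - Suc p = Max D" using Mn by (auto simp: p_def)
  have differ: "(p \<in> ?X) \<noteq> (p \<in> ?Y)" using M(1) pM by (auto simp: pos D_def)
  have agree: "(j \<in> ?X) = (j \<in> ?Y)" if "j < p" for j
  proof (rule ccontr)
    assume "(j \<in> ?X) \<noteq> (j \<in> ?Y)"
    then have "?n - Suc j \<in> D" by (auto simp: pos D_def)
    then show False using M(2)[of "?n - Suc j"] that pM by simp
  qed
  have "first_less ?X ?Y \<longleftrightarrow> p \<in> ?Y"
    unfolding first_less_def using differ agree by (metis nat_neq_iff)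
  also have "\<dots> \<longleftrightarrow> ble A (as ! Max D) y" using pM by (simp add: pos)
  finally show ?thesis using False by (simp add: antilex_def D_def)
qed

context
  fixes A :: "('a, 'm) L1_struct_scheme"
  assumes ba: "boolean_alg A" and fin: "finite (univ A)"
begin

lemma ba_closed:
  "zero A \<in> univ A" "one A \<in> univ A" "x \<in> univ A \<Longrightarrow> neg A x \<in> univ A"
  "x \<in> univ A \<Longrightarrow> y \<in> univ A \<Longrightarrow> join A x y \<in> univ A"
  "x \<in> univ A \<Longrightarrow> y \<in> univ A \<Longrightarrow> meet A x y \<in> univ A"
  using ba by (auto simp: boolean_alg_def closed_under_ops_def)

lemma ba_comm:
  "x \<in> univ A \<Longrightarrow> y \<in> univ A \<Longrightarrow> join A x y = join A y x"
  "x \<in> univ A \<Longrightarrow> y \<in> univ A \<Longrightarrow> meet A x y = meet A y x"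
  using ba by (auto simp: boolean_alg_def)

lemma meet_assoc:
  "x \<in> univ A \<Longrightarrow> y \<in> univ A \<Longrightarrow> z \<in> univ A \<Longrightarrow> meet A (meet A x y) z = meet A x (meet A y z)"
  using ba by (simp add: boolean_alg_def)

lemma ba_distrib:
  "x \<in> univ A \<Longrightarrow> y \<in> univ A \<Longrightarrow> z \<in> univ A \<Longrightarrow>
    meet A x (join A y z) = join A (meet A x y) (meet A x z)"
  "x \<in> univ A \<Longrightarrow> y \<in> univ A \<Longrightarrow> z \<in> univ A \<Longrightarrow>
    join A x (meet A y z) = meet A (join A x y) (join A x z)"
  using ba by (auto simp: boolean_alg_def)

lemma ba_units:
  "x \<in> univ A \<Longrightarrow> join A x (zero A) = x" "x \<in> univ A \<Longrightarrow> meet A x (one A) = x"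
  "x \<in> univ A \<Longrightarrow> join A x (neg A x) = one A" "x \<in> univ A \<Longrightarrow> meet A x (neg A x) = zero A"
  using ba by (auto simp: boolean_alg_def)

lemma meet_idem: assumes "x \<in> univ A" shows "meet A x x = x"
proof -
  have "meet A x (join A x (neg A x)) = join A (meet A x x) (meet A x (neg A x))"
    using assms by (intro ba_distrib ba_closed)
  then show ?thesis using assms by (simp add: ba_units ba_closed)
qed

lemma meet_zero: assumes "x \<in> univ A" shows "meet A x (zero A) = zero A"
proof -
  have "meet A x (zero A) = join A (meet A x (zero A)) (meet A x (neg A x))"
    using assms by (simp add: ba_units ba_closed)
  also have "\<dots> = meet A x (join A (neg A x) (zero A))"
    using assms by (simp add: ba_distrib(1)[symmetric] ba_comm(1)[of "zero A"] ba_closed)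
  also have "\<dots> = zero A" using assms by (simp add: ba_units ba_closed)
  finally show ?thesis .
qed

lemma join_one: assumes "x \<in> univ A" shows "join A x (one A) = one A"
proof -
  have "join A x (one A) = meet A (join A x (one A)) (join A x (neg A x))"
    using assms by (simp add: ba_units ba_closed)
  also have "\<dots> = join A x (meet A (neg A x) (one A))"
    using assms by (simp add: ba_distrib(2)[symmetric] ba_comm(2)[of "one A"] ba_closed)
  also have "\<dots> = one A" using assms by (simp add: ba_units ba_closed)
  finally show ?thesis .
qed

lemma ba_absorb: assumes "x \<in> univ A" "y \<in> univ A" shows "meet A x (join A x y) = x"
proof -
  have "meet A x (join A x y) = join A (meet A x (one A)) (meet A x y)"
    using assms by (simp add: ba_distrib(1) meet_idem ba_units)
  also have "\<dots> = meet A x (join A y (one A))"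
    using assms by (simp add: ba_distrib(1)[symmetric] ba_comm(1)[of "one A"] ba_closed)
  also have "\<dots> = x" using assms by (simp add: join_one ba_units)
  finally show ?thesis .
qed

lemma ble_refl: "x \<in> univ A \<Longrightarrow> ble A x x"
  by (simp add: ble_def meet_idem)

lemma ble_antisym: "x \<in> univ A \<Longrightarrow> y \<in> univ A \<Longrightarrow> ble A x y \<Longrightarrow> ble A y x \<Longrightarrow> x = y"
  using ba_comm(2)[of x y] by (simp add: ble_def)

lemma ble_trans:
  "x \<in> univ A \<Longrightarrow> y \<in> univ A \<Longrightarrow> z \<in> univ A \<Longrightarrow> ble A x y \<Longrightarrow> ble A y z \<Longrightarrow> ble A x z"
  using meet_assoc[of x y z] by (simp add: ble_def)

lemma meet_below:
  assumes "x \<in> univ A" "y \<in> univ A"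
  shows "ble A (meet A x y) x" "ble A (meet A x y) y"
  using assms meet_assoc[of y x x] meet_assoc[of x y y] ba_comm(2)[of x y]
  by (simp_all add: ble_def meet_idem)

lemma ble_meet_iff:
  assumes "a \<in> univ A" "x \<in> univ A" "y \<in> univ A"
  shows "ble A a (meet A x y) \<longleftrightarrow> ble A a x \<and> ble A a y"
proof
  assume "ble A a (meet A x y)"
  then show "ble A a x \<and> ble A a y"
    using assms ble_trans[of a "meet A x y"] meet_below[of x y] ba_closed(5)[of x y] by simp
next
  assume "ble A a x \<and> ble A a y"
  then show "ble A a (meet A x y)"
    using assms meet_assoc[of a x y] by (simp add: ble_def)
qed

lemma ble_join_left: "x \<in> univ A \<Longrightarrow> y \<in> univ A \<Longrightarrow> ble A x (join A x y)"
  by (simp add: ble_def ba_absorb)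

lemma atomD: "a \<in> atoms A \<Longrightarrow> a \<in> univ A" "a \<in> atoms A \<Longrightarrow> a \<noteq> zero A"
  by (auto simp: atoms_def)

lemma atom_not_below_zero: "a \<in> atoms A \<Longrightarrow> \<not> ble A a (zero A)"
  using atomD[of a] by (auto simp: ble_def meet_zero)

lemma atom_below_one: "a \<in> atoms A \<Longrightarrow> ble A a (one A)"
  by (auto simp: ble_def ba_units atomD)

lemma atom_below_or_disjoint:
  assumes "a \<in> atoms A" "x \<in> univ A"
  shows "ble A a x \<or> meet A a x = zero A"
proof -
  have "meet A a x = zero A \<or> meet A a x = a"
    using assms meet_below[of a x] by (auto simp: atoms_def ba_closed)
  then show ?thesis by (auto simp: ble_def)
qed

lemma atom_below_join_iff:
  assumes a: "a \<in> atoms A" and x: "x \<in> univ A" and y: "y \<in> univ A"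
  shows "ble A a (join A x y) \<longleftrightarrow> ble A a x \<or> ble A a y"
proof
  assume l: "ble A a (join A x y)"
  show "ble A a x \<or> ble A a y"
  proof (rule ccontr)
    assume "\<not> (ble A a x \<or> ble A a y)"
    then have "meet A a x = zero A" "meet A a y = zero A"
      using atom_below_or_disjoint[OF a] x y by auto
    then have "meet A a (join A x y) = zero A"
      using ba_distrib(1)[of a x y] atomD[OF a] x y by (simp add: ba_units ba_closed)
    then show False using l atomD[OF a] by (simp add: ble_def)
  qed
next
  assume "ble A a x \<or> ble A a y"
  then show "ble A a (join A x y)"
    using ble_trans[of a x "join A x y"] ble_trans[of a y "join A x y"] ble_join_left[of x y]
      ble_join_left[of y x] ba_comm(1)[of x y] atomD[OF a] x y ba_closed(4)[of x y] by auto
qed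

lemma atom_below_neg_iff:
  assumes a: "a \<in> atoms A" and x: "x \<in> univ A"
  shows "ble A a (neg A x) \<longleftrightarrow> \<not> ble A a x"
proof -
  have "ble A a x \<or> ble A a (neg A x)"
    using atom_below_join_iff[OF a x ba_closed(3)[OF x]] atom_below_one[OF a] x by (simp add: ba_units)
  moreover have "\<not> (ble A a x \<and> ble A a (neg A x))"
    using ble_meet_iff[OF atomD(1)[OF a] x ba_closed(3)[OF x]] atom_not_below_zero[OF a] x
    by (simp add: ba_units)
  ultimately show ?thesis by blast
qed

text \<open>
  A nonzero element below \<open>x\<close> with the least number of elements below it is an atom.
\<close>
lemma atom_below_exists:
  assumes x: "x \<in> univ A" "x \<noteq> zero A"
  shows "\<exists>a\<in>atoms A. ble A a x"
proof -
  let ?P = "\<lambda>y. y \<in> univ A \<and> y \<noteq> zero A \<and> ble A y x"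
  let ?d = "\<lambda>y. {z \<in> univ A. ble A z y}"
  have "?P x" using x ble_refl[of x] by simp
  then obtain a where a: "?P a" and least: "\<And>y. ?P y \<Longrightarrow> card (?d a) \<le> card (?d y)"
    using ex_has_least_nat[of ?P x "\<lambda>y. card (?d y)"] by blast
  have "y = zero A \<or> y = a" if y: "y \<in> univ A" "ble A y a" for y
  proof (rule ccontr)
    assume ne: "\<not> (y = zero A \<or> y = a)"
    then have "?P y" using y a x ble_trans[of y a x] by simp
    moreover have "?d y \<subset> ?d a"
    proof
      show "?d y \<subseteq> ?d a" using y a ble_trans by blast
      have "\<not> ble A a y" using ne y a ble_antisym by blast
      then show "?d y \<noteq> ?d a" using a ble_refl[of a] by blast
    qed
    then have "card (?d y) < card (?d a)" using fin by (intro psubset_card_mono) auto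
    ultimately show False using least by fastforce
  qed
  then have "a \<in> atoms A" using a by (simp add: atoms_def)
  then show ?thesis using a by blast
qed

lemma ble_if_atoms_below:
  assumes x: "x \<in> univ A" and y: "y \<in> univ A"
    and le: "\<And>a. a \<in> atoms A \<Longrightarrow> ble A a x \<Longrightarrow> ble A a y"
  shows "ble A x y"
proof (rule ccontr)
  assume n: "\<not> ble A x y"
  have "meet A x (neg A y) \<noteq> zero A"
  proof
    assume z: "meet A x (neg A y) = zero A"
    have "meet A x (join A y (neg A y)) = join A (meet A x y) (meet A x (neg A y))"
      using x y by (intro ba_distrib ba_closed)
    then have "meet A x y = x" using x y z by (simp add: ba_units ba_closed)
    then show False using n by (simp add: ble_def)
  qed
  then obtain a where a: "a \<in> atoms A" "ble A a (meet A x (neg A y))"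
    using atom_below_exists[of "meet A x (neg A y)"] x y by (auto simp: ba_closed)
  then have "ble A a x" "ble A a (neg A y)"
    using ble_meet_iff[of a x "neg A y"] atomD(1)[of a] x y by (auto simp: ba_closed)
  then show False using le[OF a(1)] atom_below_neg_iff[OF a(1) y] by simp
qed

context
  fixes as
  assumes atoms: "set as = atoms A" "distinct as"
begin

lemma rev_nth_atom: "i < length as \<Longrightarrow> rev as ! i \<in> atoms A"
  using atoms(1) nth_mem[of i "rev as"] by simp

lemma atom_positions_inj:
  assumes "x \<in> univ A" "y \<in> univ A" "atom_positions A as x = atom_positions A as y"
  shows "x = y"
proof -
  have "ble A a x \<longleftrightarrow> ble A a y" if a: "a \<in> atoms A" for a
  proof -
    have "a \<in> set (rev as)" using atoms(1) a by simp
    then obtain i where "i < length as" "rev as ! i = a" unfolding in_set_conv_nth by auto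
    then show ?thesis using assms(3) by (auto simp: atom_positions_def set_eq_iff)
  qed
  then show ?thesis
    using ble_antisym[of x y] ble_if_atoms_below[of x y] ble_if_atoms_below[of y x] assms(1,2) by simp
qed

text \<open>
  Joins of atoms realise every set of positions. The join stays in an ideal \<open>I\<close> if
  all its atoms are in \<open>I\<close>; since \<open>atom_positions\<close> is injective, this determines the ideal from
  its atoms. The set \<open>Z\<close> stands for the positions of atoms known to be in \<open>I\<close>.
\<close>
lemma atom_positions_surj:
  assumes "Y \<subseteq> {..<length as}"
    and I: "nontrivial_ideal A I" "\<And>i. i \<in> Y \<Longrightarrow> i \<in> Z \<Longrightarrow> rev as ! i \<in> I"
  shows "\<exists>z\<in>univ A. atom_positions A as z = Y \<and> (Y \<subseteq> Z \<longrightarrow> z \<in> I)"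
proof -
  have "finite Y" using assms(1) finite_subset by blast
  then show ?thesis using assms(1) I(2)
  proof (induction Y)
    case empty
    have "atom_positions A as (zero A) = {}"
      using atom_not_below_zero rev_nth_atom by (auto simp: atom_positions_def)
    then show ?case using ba_closed I(1) by (auto simp: nontrivial_ideal_def)
  next
    case (insert i Y)
    then obtain z where z: "z \<in> univ A" "atom_positions A as z = Y" "Y \<subseteq> Z \<longrightarrow> z \<in> I" by auto
    have i: "i < length as" using insert.prems by simp
    let ?b = "rev as ! i"
    have b: "?b \<in> atoms A" "?b \<in> univ A" using rev_nth_atom i atomD by auto
    have "j = i" if "j < length as" "ble A (rev as ! j) ?b" for j
    proof -
      have "rev as ! j = ?b"
        using rev_nth_atom[OF that(1)] b(1) that(2) by (auto simp: atoms_def)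
      then show ?thesis using nth_eq_iff_index_eq[of "rev as" j i] atoms(2) that i by simp
    qed
    then have "atom_positions A as (join A z ?b) = insert i Y"
      using z i b ble_refl[of ?b] rev_nth_atom
      by (auto simp: atom_positions_def atom_below_join_iff)
    moreover have "join A z ?b \<in> I" if "insert i Y \<subseteq> Z"
      using that z insert.prems(2)[of i] I(1) by (auto simp: nontrivial_ideal_def)
    ultimately show ?case
      by (intro bexI[of _ "join A z ?b"]) (simp_all add: z(1) b(2) ba_closed(4))
  qed
qed

lemma atom_positions_zero_one:
  "atom_positions A as (zero A) = {}" "atom_positions A as (one A) = {..<length as}"
  by (auto simp: atom_positions_def rev_nth_atom atom_not_below_zero atom_below_one)

lemma atom_positions_ops:
  assumes "x \<in> univ A" "y \<in> univ A"
  shows "atom_positions A as (neg A x) = {..<length as} - atom_positions A as x"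
    "atom_positions A as (join A x y) = atom_positions A as x \<union> atom_positions A as y"
    "atom_positions A as (meet A x y) = atom_positions A as x \<inter> atom_positions A as y"
  unfolding atom_positions_def
  using assms rev_nth_atom atom_below_neg_iff[of _ x] atom_below_join_iff[of _ x y]
    ble_meet_iff[of _ x y] atomD(1)
  by (simp_all add: set_eq_iff) blast+

end

end

text \<open>
  Finiteness makes the algebra a power set of its atoms. The unique atom outside the ideal is the last
  one of any proper ordering, hence at position 0 of the reversed list, and an element is in the ideal
  iff it is not above this atom.
\<close>
theorem NA_Bu_isomorphic_std_algebra:
  assumes "A \<in> NA_Bu"
  obtains m f where "embedding f A (std_algebra (Suc m))" "f ` univ A = univ (std_algebra (Suc m))"
proof -
  have fin: "finite (univ A)" and ba: "boolean_alg A" and ideal: "nontrivial_ideal A (P0 A)"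
    and uniq: "\<exists>!a. a \<in> atoms A \<and> a \<notin> P0 A"
    using assms by (auto simp: NA_Bu_def in_Bu_def)
  obtain as where as: "distinct as" "set as = atoms A"
    and proper: "\<And>i j. i < length as \<Longrightarrow> j < length as \<Longrightarrow> as ! i \<in> P0 A \<Longrightarrow> as ! j \<notin> P0 A \<Longrightarrow> i < j"
    and lt: "\<And>x y. x \<in> univ A \<Longrightarrow> y \<in> univ A \<Longrightarrow> lt A x y \<longleftrightarrow> antilex A as x y"
    using assms by (auto simp: NA_Bu_def natural_ordering_def proper_ordering_def)
  obtain q where q: "q < length as" "as ! q \<notin> P0 A"
    using uniq as(2) by (metis in_set_conv_nth)
  have others: "as ! i \<in> P0 A" "i < q" if "i < length as" "i \<noteq> q" for i
  proof -
    have "as ! i \<noteq> as ! q" using as(1) that q nth_eq_iff_index_eq by blast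
    then show "as ! i \<in> P0 A" using uniq q as(2) that nth_mem by metis
    then show "i < q" using proper that q by blast
  qed
  obtain m where m: "length as = Suc m" using q(1) by (cases "length as") auto
  have "q = m" using others(2)[of m] m q(1) by fastforce
  have rev0: "rev as ! 0 \<notin> P0 A" using q \<open>q = m\<close> m by (simp add: rev_nth)
  have revS: "rev as ! i \<in> P0 A" if "i < Suc m" "i \<noteq> 0" for i
    using others(1)[of "m - i"] \<open>q = m\<close> m that by (simp add: rev_nth)
  note surj = atom_positions_surj[OF ba fin as(2,1) _ ideal, of _ "- {0}"]
  note inj = atom_positions_inj[OF ba fin as(2,1)]
  note ops = atom_positions_ops[OF ba fin as(2,1)] atom_positions_zero_one[OF ba fin as(2,1)]
  let ?f = "atom_positions A as"
  have sub: "?f x \<subseteq> {..<Suc m}" for x using m by (auto simp: atom_positions_def)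
  have P0: "x \<in> P0 A \<longleftrightarrow> 0 \<notin> ?f x" if x: "x \<in> univ A" for x
  proof
    assume "x \<in> P0 A"
    then show "0 \<notin> ?f x"
      using rev0 ideal rev_nth_atom[OF ba fin as(2,1), of 0] m
      by (auto simp: atom_positions_def nontrivial_ideal_def atoms_def)
  next
    assume "0 \<notin> ?f x"
    then obtain z where "z \<in> univ A" "?f z = ?f x" "z \<in> P0 A"
      using surj[of "?f x"] sub[of x] revS m by auto
    then show "x \<in> P0 A" using inj x by blast
  qed
  have "lt A x y \<longleftrightarrow> first_less (?f x) (?f y)" if "x \<in> univ A" "y \<in> univ A" for x y
    using lt[OF that] antilex_iff_first_less[of x y A as] inj[OF that] by blast
  moreover have "inj_on ?f (univ A)" using inj by (auto simp: inj_on_def)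
  moreover have "?f ` univ A \<subseteq> Pow {..<Suc m}" using sub by blast
  ultimately have "embedding ?f A (std_algebra (Suc m))"
    unfolding embedding_def using ops P0 sub m by simp
  moreover have "?f ` univ A = univ (std_algebra (Suc m))"
  proof -
    have "\<exists>z\<in>univ A. ?f z = Y" if "Y \<subseteq> {..<Suc m}" for Y
      using surj[of Y] that revS m by auto
    then have "Pow {..<Suc m} \<subseteq> ?f ` univ A" by (auto simp: image_iff)
    then show ?thesis using \<open>?f ` univ A \<subseteq> Pow {..<Suc m}\<close> by (simp only: std_algebra_simps subset_antisym)
  qed
  ultimately show ?thesis by (rule that)
qed

section \<open>Standard algebras inside an arbitrary infinite type\<close>

text \<open>
  The standard algebra with \<open>n\<close> atoms, transported along an injective coding \<open>e\<close> of its elements.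
\<close>
definition coded :: "(nat set \<Rightarrow> 'a) \<Rightarrow> nat \<Rightarrow> 'a L1_ord_struct" where
  "coded e n = (let d = inv_into (Pow {..<n}) e in
     \<lparr>univ = e ` Pow {..<n}, join = (\<lambda>x y. e (d x \<union> d y)), meet = (\<lambda>x y. e (d x \<inter> d y)),
      zero = e {}, one = e {..<n}, neg = (\<lambda>x. e ({..<n} - d x)),
      P0 = e ` P0 (std_algebra n), lt = (\<lambda>x y. first_less (d x) (d y))\<rparr>)"

lemma coded_simps:
  assumes "inj_on e (Pow {..<n})"
  shows "univ (coded e n) = e ` Pow {..<n}" "zero (coded e n) = e {}" "one (coded e n) = e {..<n}"
    "P0 (coded e n) = e ` {X. X \<subseteq> {..<n} \<and> 0 \<notin> X}"
    "X \<subseteq> {..<n} \<Longrightarrow> neg (coded e n) (e X) = e ({..<n} - X)"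
    "X \<subseteq> {..<n} \<Longrightarrow> Y \<subseteq> {..<n} \<Longrightarrow> join (coded e n) (e X) (e Y) = e (X \<union> Y)"
    "X \<subseteq> {..<n} \<Longrightarrow> Y \<subseteq> {..<n} \<Longrightarrow> meet (coded e n) (e X) (e Y) = e (X \<inter> Y)"
    "X \<subseteq> {..<n} \<Longrightarrow> Y \<subseteq> {..<n} \<Longrightarrow> lt (coded e n) (e X) (e Y) = first_less X Y"
    "X \<subseteq> {..<n} \<Longrightarrow> Y \<subseteq> {..<n} \<Longrightarrow> e X = e Y \<longleftrightarrow> X = Y"
proof -
  have [simp]: "inv_into (Pow {..<n}) e (e X) = X" if "X \<subseteq> {..<n}" for X
    using assms that by simp
  show "univ (coded e n) = e ` Pow {..<n}" "zero (coded e n) = e {}" "one (coded e n) = e {..<n}"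
    "P0 (coded e n) = e ` {X. X \<subseteq> {..<n} \<and> 0 \<notin> X}"
    "X \<subseteq> {..<n} \<Longrightarrow> neg (coded e n) (e X) = e ({..<n} - X)"
    "X \<subseteq> {..<n} \<Longrightarrow> Y \<subseteq> {..<n} \<Longrightarrow> join (coded e n) (e X) (e Y) = e (X \<union> Y)"
    "X \<subseteq> {..<n} \<Longrightarrow> Y \<subseteq> {..<n} \<Longrightarrow> meet (coded e n) (e X) (e Y) = e (X \<inter> Y)"
    "X \<subseteq> {..<n} \<Longrightarrow> Y \<subseteq> {..<n} \<Longrightarrow> lt (coded e n) (e X) (e Y) = first_less X Y"
    by (simp_all add: coded_def Let_def)
  show "X \<subseteq> {..<n} \<Longrightarrow> Y \<subseteq> {..<n} \<Longrightarrow> e X = e Y \<longleftrightarrow> X = Y"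
    using assms by (simp add: inj_on_eq_iff)
qed

lemma embedding_coded:
  assumes e: "inj_on e (Pow {..<n})"
  shows "embedding e (std_algebra n) (coded e n)"
  unfolding embedding_def std_algebra_simps using e coded_simps[OF e] by auto

lemma coded_in_NA_Bu:
  assumes e: "inj_on e (Pow {..<n})" and n: "0 < n"
  shows "coded e n \<in> NA_Bu"
proof -
  note simps = coded_simps[OF e]
  let ?C = "coded e n"
  have sub: "X \<inter> Y \<subseteq> {..<n}" if "X \<subseteq> {..<n}" for X Y using that by blast
  have ble: "ble ?C (e X) (e Y) \<longleftrightarrow> X \<subseteq> Y" if "X \<subseteq> {..<n}" "Y \<subseteq> {..<n}" for X Y
    using that sub[of X Y] by (auto simp: ble_def simps)
  have ba: "boolean_alg ?C"
  proof -
    have mem: "e X \<in> e ` Pow {..<n}" if "X \<subseteq> {..<n}" for X using that by blast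
    have "closed_under_ops ?C (univ ?C)"
      unfolding closed_under_ops_def by (auto simp: simps(1-3,5-7) sub intro!: mem)
    then show ?thesis
      unfolding boolean_alg_def
      by (auto simp: simps(1-3,5-7) sub intro!: arg_cong[where f = e])
  qed
  have P0: "e X \<in> P0 ?C \<longleftrightarrow> 0 \<notin> X" if "X \<subseteq> {..<n}" for X
    using that by (auto simp: simps)
  have ideal: "nontrivial_ideal ?C (P0 ?C)"
    unfolding nontrivial_ideal_def
  proof (intro conjI ballI impI)
    show "P0 ?C \<subseteq> univ ?C" "zero ?C \<in> P0 ?C" by (auto simp: simps(1,2,4))
    show "one ?C \<notin> P0 ?C" using n P0[of "{..<n}"] by (simp add: simps(3))
  next
    fix x assume "x \<in> P0 ?C"
    then obtain X where X: "X \<subseteq> {..<n}" "0 \<notin> X" "x = e X" by (auto simp: simps(4))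
    {
      fix y assume "y \<in> univ ?C" "ble ?C y x"
      then obtain Y where "Y \<subseteq> {..<n}" "y = e Y" "Y \<subseteq> X" using X ble by (auto simp: simps(1))
      then show "y \<in> P0 ?C" using X P0[of Y] by auto
    }
    fix y assume "y \<in> P0 ?C"
    then obtain Y where "Y \<subseteq> {..<n}" "0 \<notin> Y" "y = e Y" by (auto simp: simps(4))
    then show "join ?C x y \<in> P0 ?C" using X P0[of "X \<union> Y"] by (simp add: simps(6))
  qed
  have atoms: "atoms ?C = (\<lambda>i. e {i}) ` {..<n}"
  proof (intro equalityI subsetI)
    fix x assume x: "x \<in> atoms ?C"
    then obtain X where X: "X \<subseteq> {..<n}" "x = e X" by (auto simp: atoms_def simps)
    then have "X \<noteq> {}" and min: "\<And>Y. Y \<subseteq> X \<Longrightarrow> Y = {} \<or> Y = X"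
      using x by (auto simp: atoms_def simps ble)
    then obtain i where "i \<in> X" by blast
    then have "X = {i}" using min[of "{i}"] by auto
    then show "x \<in> (\<lambda>i. e {i}) ` {..<n}" using X by auto
  next
    fix x assume "x \<in> (\<lambda>i. e {i}) ` {..<n}"
    then obtain i where "i < n" "x = e {i}" by blast
    then show "x \<in> atoms ?C" by (auto simp: atoms_def simps ble)
  qed
  have uniq: "\<exists>!a. a \<in> atoms ?C \<and> a \<notin> P0 ?C"
    using n by (intro ex1I[of _ "e {0}"]) (auto simp: atoms P0)
  define as where "as = rev (map (\<lambda>i. e {i}) [0..<n])"
  have as_nth: "as ! i = e {n - Suc i}" if "i < n" for i
    using that by (simp add: as_def rev_nth)
  have proper: "proper_ordering ?C as"
    unfolding proper_ordering_def
  proof (intro conjI allI impI)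
    show "distinct as" by (auto simp: as_def distinct_map inj_on_def simps)
    show "set as = atoms ?C" by (auto simp: as_def atoms)
    fix i j assume "i < length as" "j < length as" "as ! i \<in> P0 ?C \<and> as ! j \<notin> P0 ?C"
    moreover from this have "i < n" "j < n" by (auto simp: as_def)
    ultimately have "n - Suc i \<noteq> 0" "n - Suc j = 0" by (auto simp: as_nth P0)
    then show "i < j" by simp
  qed
  have pos: "atom_positions ?C as (e X) = X" if "X \<subseteq> {..<n}" for X
  proof -
    have "rev as ! i = e {i}" if "i < n" for i using that by (simp add: as_def)
    then have "atom_positions ?C as (e X) = {i. i < n \<and> {i} \<subseteq> X}"
      using that ble by (auto simp: atom_positions_def as_def)
    then show ?thesis using that by auto
  qed
  have "lt ?C (e X) (e Y) \<longleftrightarrow> antilex ?C as (e X) (e Y)" if "X \<subseteq> {..<n}" "Y \<subseteq> {..<n}" for X Y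
    using antilex_iff_first_less[of "e X" "e Y" ?C as] that by (auto simp: pos simps)
  then have "natural_ordering ?C (lt ?C)"
    using proper unfolding natural_ordering_def by (auto simp: simps(1))
  then show ?thesis using ba ideal uniq by (simp add: NA_Bu_def in_Bu_def simps(1))
qed

section \<open>The Ramsey property\<close>

lemma closed_if_NA_Bu: "A \<in> NA_Bu \<Longrightarrow> closed_under_ops A (univ A)"
  by (auto simp: NA_Bu_def in_Bu_def boolean_alg_def)

lemma NA_Bu_std_algebra_inverse:
  assumes "A \<in> NA_Bu"
  obtains m f g where "embedding f A (std_algebra (Suc m))" "f ` univ A = univ (std_algebra (Suc m))"
    "embedding g (std_algebra (Suc m)) A" "g ` univ (std_algebra (Suc m)) = univ A"
proof -
  obtain m f where f: "embedding f A (std_algebra (Suc m))" "f ` univ A = univ (std_algebra (Suc m))"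
    using NA_Bu_isomorphic_std_algebra[OF assms] .
  have id: "embedding id (std_algebra (Suc m)) (std_algebra (Suc m))" by (simp add: embedding_def)
  obtain g where g: "embedding g (std_algebra (Suc m)) A" "\<And>X. X \<in> univ (std_algebra (Suc m)) \<Longrightarrow> f (g X) = id X"
    using embedding_factor[OF closed_std_algebra closed_if_NA_Bu[OF assms] id f(1)] f(2) by auto
  have "x \<in> g ` univ (std_algebra (Suc m))" if x: "x \<in> univ A" for x
  proof -
    have fx: "f x \<in> univ (std_algebra (Suc m))" using f(2) x by blast
    then have "g (f x) \<in> univ A" "f (g (f x)) = f x" using g by (auto simp: embedding_def)
    then have "g (f x) = x" using f(1) x by (auto simp: embedding_def inj_on_def)
    then show ?thesis using fx by (metis image_eqI)
  qed
  moreover have "g ` univ (std_algebra (Suc m)) \<subseteq> univ A" using g(1) by (simp add: embedding_def)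
  ultimately have "g ` univ (std_algebra (Suc m)) = univ A" by blast
  with f g(1) show ?thesis by (rule that)
qed

text \<open>
  The witness \<open>C\<close> is a coded standard algebra whose number of atoms comes from \<open>dual_ramsey\<close>. A word is
  coloured by the colour of its subalgebra. The copies of \<open>A\<close> inside the subalgebra
  of a word \<open>F\<close> are the subalgebras of the words \<open>subst 0 F v\<close>: factor an embedding of \<open>A\<close> through the
  embedding given by \<open>F\<close>.
\<close>
theorem theorem5:
  shows "ramsey_property (NA_Bu :: 'a::infinite L1_ord_struct set)"
  unfolding ramsey_property_def
proof (intro ballI allI impI)
  fix A B :: "'a L1_ord_struct" and k :: nat
  assume A: "A \<in> NA_Bu" and B: "B \<in> NA_Bu" and k: "embeds A B \<and> 2 \<le> k"
  obtain a \<alpha> \<alpha>' where \<alpha>: "embedding \<alpha> A (std_algebra (Suc a))" "\<alpha> ` univ A = univ (std_algebra (Suc a))"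
    and \<alpha>': "embedding \<alpha>' (std_algebra (Suc a)) A" "\<alpha>' ` univ (std_algebra (Suc a)) = univ A"
    using NA_Bu_std_algebra_inverse[OF A] .
  obtain b \<beta> where \<beta>: "embedding \<beta> B (std_algebra (Suc b))" "\<beta> ` univ B = univ (std_algebra (Suc b))"
    using NA_Bu_isomorphic_std_algebra[OF B] .
  obtain n where n: "homogenizable k (param_words 0 n (Suc b)) (subspace_pairs 0 (Suc b) (Suc a))"
    using dual_ramsey by blast
  have "0 < n"
  proof -
    obtain F where "F \<in> param_words 0 n (Suc b)"
      using n[unfolded homogenizable_def, rule_format, of "\<lambda>_. 0"] k by auto
    then show ?thesis by (cases n) (auto simp: param_words_def)
  qed
  obtain e :: "nat set \<Rightarrow> 'a" where e: "inj_on e (Pow {..<n})"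
  proof -
    obtain T :: "'a set" where T: "finite T" "card T = card (Pow {..<n})"
      using infinite_arbitrarily_large[OF infinite_UNIV] by blast
    then obtain e where "bij_betw e (Pow {..<n}) T"
      using finite_same_card_bij[of "Pow {..<n}" T] by auto
    then show ?thesis using that bij_betw_imp_inj_on by blast
  qed
  define C where "C = coded e n"
  have C: "C \<in> NA_Bu" unfolding C_def using coded_in_NA_Bu[OF e \<open>0 < n\<close>] .
  \<comment> \<open>The universe of the subalgebra of \<open>C\<close> belonging to a word \<open>w\<close> with \<open>Suc j\<close> symbols.\<close>
  define S where "S j w = e ` word_preimage w ` Pow {..<Suc j}" for j w
  have emb: "embedding (e \<circ> word_preimage w) (std_algebra (Suc j)) C" if "w \<in> param_words 0 n (Suc j)" for j w
    unfolding C_def using embedding_comp[OF embedding_word_preimage[OF that] embedding_coded[OF e]] .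
  have "\<exists>S\<in>copies B C. \<exists>c. \<forall>T\<in>copies A (induced C S). \<chi> T = c"
    if \<chi>: "\<chi> ` copies A C \<subseteq> {..<k}" for \<chi> :: "'a set \<Rightarrow> nat"
  proof -
    \<comment> \<open>The colouring is bounded by \<open>k\<close> on copies of \<open>A\<close> only;
          reduction modulo \<open>k\<close> bounds it on all words without changing the colour of a copy.\<close>
    have "\<forall>w. \<chi> (S a w) mod k < k" using k by simp
    then obtain F where F: "F \<in> param_words 0 n (Suc b)"
      and mono: "\<forall>(x, y)\<in>subspace_pairs 0 (Suc b) (Suc a) F. \<chi> (S a x) mod k = \<chi> (S a y) mod k"
      using n[unfolded homogenizable_def, rule_format, of "\<lambda>w. \<chi> (S a w) mod k"] by blast
    have "S b F = (e \<circ> word_preimage F \<circ> \<beta>) ` univ B"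
      using \<beta>(2) unfolding image_comp[symmetric] by (simp only: S_def std_algebra_simps)
    then have SF: "S b F \<in> copies B C"
      using embedding_comp[OF \<beta>(1) emb[OF F]] copies_eq[OF closed_if_NA_Bu[OF B], of C] by blast
    have SC: "S b F \<subseteq> univ C" using emb[OF F] by (auto simp: S_def embedding_def)
    have copy: "\<exists>v. v \<in> param_words 0 (Suc b) (Suc a) \<and> T = S a (subst 0 F v) \<and> \<chi> T < k"
      if T: "T \<in> copies A (induced C (S b F))" for T
    proof -
      obtain f where f: "embedding f A (induced C (S b F))" "T = f ` univ A"
        using T unfolding copies_eq[OF closed_if_NA_Bu[OF A]] by blast
      have fC: "embedding f A C" "f ` univ A \<subseteq> S b F"
        using embedding_induced_iff[of f A C "S b F"] f(1) SC by auto
      have "T \<in> copies A C" using fC(1) f(2) unfolding copies_eq[OF closed_if_NA_Bu[OF A]] by blast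
      then have "\<chi> T < k" using \<chi> by blast
      have im: "(f \<circ> \<alpha>') ` univ (std_algebra (Suc a)) = T"
        using \<alpha>'(2) f(2) unfolding image_comp[symmetric] by simp
      have "(f \<circ> \<alpha>') ` univ (std_algebra (Suc a)) \<subseteq> (e \<circ> word_preimage F) ` univ (std_algebra (Suc b))"
        unfolding im using fC(2) f(2) by (simp add: S_def image_comp)
      then obtain h where h: "embedding h (std_algebra (Suc a)) (std_algebra (Suc b))"
        "\<And>X. X \<in> univ (std_algebra (Suc a)) \<Longrightarrow> (e \<circ> word_preimage F) (h X) = (f \<circ> \<alpha>') X"
        using embedding_factor[OF closed_std_algebra closed_std_algebra embedding_comp[OF \<alpha>'(1) fC(1)] emb[OF F]]
        by blast
      obtain v where v: "v \<in> param_words 0 (Suc b) (Suc a)"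
        "\<And>X. X \<subseteq> {..<Suc a} \<Longrightarrow> h X = word_preimage v X"
        using embedding_std_algebra_word_preimage[OF h(1)] by blast
      have "set F \<subseteq> {..<length v}" using param_words_set[OF F] v(1) by (simp add: param_words_def)
      then have "(f \<circ> \<alpha>') X = e (word_preimage (subst 0 F v) X)" if "X \<in> univ (std_algebra (Suc a))" for X
        using h(2)[OF that] v(2)[of X] that by (simp add: word_preimage_subst)
      then have "T = S a (subst 0 F v)"
        unfolding im[symmetric] S_def image_comp by (intro image_cong) simp_all
      then show ?thesis using v(1) \<open>\<chi> T < k\<close> by blast
    qed
    have "\<chi> T = \<chi> T'"
      if TT: "T \<in> copies A (induced C (S b F))" "T' \<in> copies A (induced C (S b F))" for T T'
    proof -
      obtain v v' where "v \<in> param_words 0 (Suc b) (Suc a)" "v' \<in> param_words 0 (Suc b) (Suc a)"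
        and T: "T = S a (subst 0 F v)" "T' = S a (subst 0 F v')" "\<chi> T < k" "\<chi> T' < k"
        using copy[OF TT(1)] copy[OF TT(2)] by blast
      then have "(subst 0 F v, subst 0 F v') \<in> subspace_pairs 0 (Suc b) (Suc a) F"
        unfolding subspace_pairs_def by blast
      then have "\<chi> T mod k = \<chi> T' mod k" unfolding T(1,2) using mono by blast
      then show ?thesis using T(3,4) by simp
    qed
    then have "\<exists>c. \<forall>T\<in>copies A (induced C (S b F)). \<chi> T = c" by meson
    then show ?thesis using SF by blast
  qed
  then show "\<exists>C\<in>NA_Bu. \<forall>\<chi> :: 'a set \<Rightarrow> nat. \<chi> ` copies A C \<subseteq> {..<k} \<longrightarrow>
      (\<exists>S\<in>copies B C. \<exists>c. \<forall>T\<in>copies A (induced C S). \<chi> T = c)"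
    using C by blast
qed

end
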